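(* Let $P=(\mathcal A_P,\mathcal F_P)$ be a (possibly partial) policy over a DTD $D$. The following are equivalent: (1) $P$ is quasiconsistent; (2) $P$ is consistent; (3) $T(\mathcal A_P)\cap\mathcal F_P=\emptyset$.
   Context: Let $\mathcal L$ be an infinite set of labels and $\mathsf{str}\notin\mathcal L$ a special symbol. A DTD is a triple $D=(Ele,Rg,rt)$ where $Ele\subseteq\mathcal L$ is finite, $rt\in Ele$ is the root type, and for each $A\in Ele$, $Rg(A)$ is one of: $\mathsf{str}$, $\epsilon$, $B_1,\dots,B_n$ (concatenation), $B_1+\dots+B_n$ (disjunction), or $B_1^*$ (Kleene star), where the $B_i\in Ele$ are pairwise distinct and are called subelement types of $A$. DTDs are non-recursive: the directed graph on $Ele$ with an edge $A\to B$ whenever $B$ is a subelement type of $A$ is acyclic. $\le_D$ denotes the reflexive–transitive closure of the subelement relation. We assume every element type is reachable from the root: $rt\le_D A$ for all $A\in Ele$. An XML tree is $t=(N_t,E_t,\lambda_t,r_t,v_t)$: a finite rooted unordered tree with node set $N_t$, parent–child edge set $E_t$, root $r_t$, labelling $\lambda_t:N_t\to\mathcal L\cup\{\mathsf{str}\}$, and a function $v_t$ assigning a string to each node labelled $\mathsf{str}$. The tree $t$ conforms to $D$ at $A\in Ele$ if $\lambda_t(r_t)=A$, every node is labelled by an element of $Ele\cup\{\mathsf{str}\}$, every node labelled $B\in Ele$ has children whose labels, listed in some order, form a word of the language of the regular expression $Rg(B)$ (with $Rg(B)=\mathsf{str}$ meaning a single child labelled $\mathsf{str}$ and $\epsilon$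 meaning no children), and every node labelled $\mathsf{str}$ is a leaf with a defined string value. $I_D(A)$ is the set of trees conforming to $D$ at $A$, and $I_D=I_D(rt)$. Trees $t_1,t_2$ are isomorphic, $t_1\equiv t_2$, if there is a bijection $N_{t_1}\to N_{t_2}$ preserving root, edges, labels and string values. Atomic updates on a tree $t$: $\mathsf{insert}(n,t')$ adds the tree $t'$ with its root as a new child of $n$; $\mathsf{delete}(n)$ removes $n$ and all its descendants; $\mathsf{replace}(n,t')$ removes the subtree rooted at $n$ and attaches $t'$ (by its root) as a child of the former parent of $n$; $\mathsf{replace}(n,s)$, for a string $s$, sets the string value of $n$ to $s$. An update is valid on $t$ if $n\in N_t$ and the tree $t'$ (if present) has node set disjoint from $N_t$; $[\![op]\!](t)$ denotes the result. For a sequence, $[\![op_1;\dots;op_k]\!](t)=[\![op_k]\!](\cdots[\![op_1]\!](t)\cdots)$, and the sequence is valid on $t$ if each $op_i$ is valid on the result of $op_1;\dots;op_{i-1}$. Update access types (UATs) are expressions $(A,\mathsf{insert}(B))$, $(A,\mathsf{delete}(B))$, $(A,\mathsf{replace}(B,B'))$ with $B\neq B'$, and $(A,\mathsf{replace}(\mathsf{str},\mathsf{str}))$, with $A\in Ele$; $A$ is the element type of the UAT. Such a UAT is valid for $D$ iff, respectively: $Rg(A)=B^*$; $Rg(A)=B^*$; $Rg(A)=B_1+\dots+B_n$ with $B,B'\in\{B_1,\dots,B_n\}$, $B\neq B'$; $Rg(A)=\mathsf{str}$. $\mathrm{valid}(D)$ is the set of UATs valid for $D$. An atomic update matches a UAT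 on $t$ as follows: $\mathsf{insert}(n,t')$ matches $(A,\mathsf{insert}(B))$ if $\lambda_t(n)=A$ and $t'\in I_D(B)$; $\mathsf{delete}(n)$ matches $(A,\mathsf{delete}(B))$ if $\lambda_t(n)=B$ and the parent of $n$ is labelled $A$; $\mathsf{replace}(n,t')$ matches $(A,\mathsf{replace}(B,B'))$ if $\lambda_t(n)=B$, the parent of $n$ is labelled $A$, $t'\in I_D(B')$ and $B\neq B'$; $\mathsf{replace}(n,s)$ matches $(A,\mathsf{replace}(\mathsf{str},\mathsf{str}))$ if $\lambda_t(n)=\mathsf{str}$ and the parent of $n$ is labelled $A$. For a set $S$ of UATs, $[\![S]\!]_t$ is the set of atomic updates matching some element of $S$ on $t$. A sequence $op_1;\dots;op_k$ is allowed on $t$ by $S$ if it is valid on $t$ and $op_i\in[\![S]\!]_{t_{i-1}}$ for all $i$, where $t_0=t$ and $t_i=[\![op_i]\!](t_{i-1})$. A policy over $D$ is a pair $P=(\mathcal A,\mathcal F)$ with $\mathcal A,\mathcal F\subseteq\mathrm{valid}(D)$ and $\mathcal A\cap\mathcal F=\emptyset$ (allowed and forbidden UATs); it is total if $\mathcal A\cup\mathcal F=\mathrm{valid}(D)$ and partial otherwise. $P$ is consistent if there exist no $t\in I_D$, no sequence $op_1;\dots;op_k$ ($k\ge1$) allowed on $t$ by $\mathcal A$, and no $op_0\in[\![\mathcal F]\!]_t$ valid on $t$ and non-trivial (i.e. $[\![op_0]\!](t)\not\equiv t$) such that $[\![op_1;\dots;op_k]\!](t)\equiv[\![op_0]\!](t)$.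 Writing $P=(\mathcal A_P,\mathcal F_P)$, the information ordering is $P\sqsubseteq Q$ iff $\mathcal A_P\subseteq\mathcal A_Q$ and $\mathcal F_P\subseteq\mathcal F_Q$; then $Q$ is said to extend $P$. A policy $P$ is quasiconsistent if it has a consistent total extension. For $S\subseteq\mathrm{valid}(D)$ and $A\in Ele$ with $Rg(A)=B_1+\dots+B_n$, $G_A(S)$ is the directed graph on vertices $B_1,\dots,B_n$ with an edge $(B_i,B_j)$ iff $(A,\mathsf{replace}(B_i,B_j))\in S$, and $G_A^+(S)$ is its transitive closure. The operator $T$ on subsets of $\mathrm{valid}(D)$ is $T(S)=S\ \cup\ \{u\in\mathrm{valid}(D)\mid$ the element type $C$ of $u$ satisfies $B\le_D C$ for some $A,B$ with $Rg(A)=B^*$ and $(A,\mathsf{insert}(B)),(A,\mathsf{delete}(B))\in S\}$ $\cup\ \{u\in\mathrm{valid}(D)\mid$ the element type $C$ of $u$ satisfies $B_i\le_D C$ for some $A$ with $Rg(A)=B_1+\dots+B_n$ and $(B_i,B_i)\in G_A^+(S)\}$ $\cup\ \{(A,\mathsf{replace}(B_i,B_k))\mid Rg(A)=B_1+\dots+B_n,\ i\neq k,\ (B_i,B_k)\in G_A^+(S)\}$. *)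

theory Defs
  imports Main "HOL-Library.Multiset"
begin

section \<open>Labels, regular expressions, DTDs\<close>

text \<open>Labels are of type 'l; the special symbol str is the extra constructor Str.\<close>
datatype 'l lab = El 'l | Str

text \<open>Right-hand sides of DTD productions: str, epsilon, B1,...,Bn, B1+...+Bn, B*.\<close>
datatype 'l rg = RStr | REps | RConc "'l list" | RDisj "'l list" | RStar 'l

fun subelems :: "'l rg \<Rightarrow> 'l set" where
  "subelems RStr = {}"
| "subelems REps = {}"
| "subelems (RConc Bs) = set Bs"
| "subelems (RDisj Bs) = set Bs"
| "subelems (RStar B) = {B}"

fun rg_wf :: "'l rg \<Rightarrow> bool" where
  "rg_wf (RConc Bs) = (Bs \<noteq> [] \<and> distinct Bs)"
| "rg_wf (RDisj Bs) = (Bs \<noteq> [] \<and> distinct Bs)"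
| "rg_wf _ = True"

record 'l dtd =
  Ele :: "'l set"
  Rg  :: "'l \<Rightarrow> 'l rg"
  rt  :: "'l"

definition sub_rel :: "'l dtd \<Rightarrow> ('l \<times> 'l) set" where
  "sub_rel D = {(A, B). A \<in> Ele D \<and> B \<in> subelems (Rg D A)}"

text \<open>The order \<le>_D: reflexive-transitive closure of the subelement relation.\<close>
definition le_D :: "'l dtd \<Rightarrow> ('l \<times> 'l) set" where
  "le_D D = (sub_rel D)\<^sup>*"

definition is_dtd :: "'l dtd \<Rightarrow> bool" where
  "is_dtd D \<longleftrightarrow> finite (Ele D) \<and> rt D \<in> Ele D
     \<and> (\<forall>A \<in> Ele D. subelems (Rg D A) \<subseteq> Ele D \<and> rg_wf (Rg D A))
     \<and> acyclic (sub_rel D)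
     \<and> (\<forall>A \<in> Ele D. (rt D, A) \<in> le_D D)"

section \<open>XML trees\<close>

record ('l, 'n) xtree =
  nodes :: "'n set"
  edges :: "('n \<times> 'n) set"
  lbl   :: "'n \<Rightarrow> 'l lab"
  root  :: "'n"
  val   :: "'n \<Rightarrow> string"

text \<open>A finite rooted (unordered) tree: finite node set containing the root, edges between
nodes, the root has no parent, every other node has exactly one parent and is reachable
from the root.  Only the values val at Str-labelled nodes are meaningful.\<close>
definition is_tree :: "('l, 'n) xtree \<Rightarrow> bool" where
  "is_tree t \<longleftrightarrow> finite (nodes t) \<and> root t \<in> nodes t \<and> edges t \<subseteq> nodes t \<times> nodes t
     \<and> (\<forall>p. (p, root t) \<notin> edges t)
     \<and> (\<forall>n \<in> nodes t. n \<noteq> root t \<longrightarrow> (\<exists>!p. (p, n) \<in> edges t))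
     \<and> (\<forall>n \<in> nodes t. (root t, n) \<in> (edges t)\<^sup>*)"

definition children :: "('l, 'n) xtree \<Rightarrow> 'n \<Rightarrow> 'n set" where
  "children t n = {m. (n, m) \<in> edges t}"

definition parent :: "('l, 'n) xtree \<Rightarrow> 'n \<Rightarrow> 'n" where
  "parent t n = (THE p. (p, n) \<in> edges t)"

definition has_parent :: "('l, 'n) xtree \<Rightarrow> 'n \<Rightarrow> bool" where
  "has_parent t n \<longleftrightarrow> (\<exists>p. (p, n) \<in> edges t)"

text \<open>Multiset of child labels is a word (in some order) of the language of the expression.\<close>
fun lang_ok :: "'l rg \<Rightarrow> 'l lab multiset \<Rightarrow> bool" where
  "lang_ok RStr M = (M = {#Str#})"
| "lang_ok REps M = (M = {#})"
| "lang_ok (RConc Bs) M = (M = mset (map El Bs))"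
| "lang_ok (RDisj Bs) M = (\<exists>B \<in> set Bs. M = {#El B#})"
| "lang_ok (RStar B) M = (set_mset M \<subseteq> {El B})"

definition child_labels :: "('l, 'n) xtree \<Rightarrow> 'n \<Rightarrow> 'l lab multiset" where
  "child_labels t n = image_mset (lbl t) (mset_set (children t n))"

text \<open>t conforms to D at A, i.e. t \<in> I_D(A).\<close>
definition conforms :: "'l dtd \<Rightarrow> 'l \<Rightarrow> ('l, 'n) xtree \<Rightarrow> bool" where
  "conforms D A t \<longleftrightarrow> is_tree t \<and> lbl t (root t) = El A
     \<and> (\<forall>n \<in> nodes t. lbl t n \<in> El ` Ele D \<union> {Str})
     \<and> (\<forall>n \<in> nodes t. \<forall>B. lbl t n = El B \<longrightarrow> lang_ok (Rg D B) (child_labels t n))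
     \<and> (\<forall>n \<in> nodes t. lbl t n = Str \<longrightarrow> children t n = {})"

definition I_D :: "'l dtd \<Rightarrow> 'l \<Rightarrow> ('l, 'n) xtree set" where
  "I_D D A = {t. conforms D A t}"

definition iso :: "('l, 'n) xtree \<Rightarrow> ('l, 'n) xtree \<Rightarrow> bool" where
  "iso t1 t2 \<longleftrightarrow> (\<exists>f. bij_betw f (nodes t1) (nodes t2) \<and> f (root t1) = root t2
     \<and> (\<forall>a \<in> nodes t1. \<forall>b \<in> nodes t1. (a, b) \<in> edges t1 \<longleftrightarrow> (f a, f b) \<in> edges t2)
     \<and> (\<forall>a \<in> nodes t1. lbl t2 (f a) = lbl t1 a)
     \<and> (\<forall>a \<in> nodes t1. lbl t1 a = Str \<longrightarrow> val t2 (f a) = val t1 a))"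

section \<open>Atomic updates\<close>

datatype ('l, 'n) upd =
    Ins 'n "('l, 'n) xtree"
  | Del 'n
  | Rep 'n "('l, 'n) xtree"
  | RepS 'n string

definition desc :: "('l, 'n) xtree \<Rightarrow> 'n \<Rightarrow> 'n set" where
  "desc t n = {m. (n, m) \<in> (edges t)\<^sup>*}"

fun apply_upd :: "('l, 'n) xtree \<Rightarrow> ('l, 'n) upd \<Rightarrow> ('l, 'n) xtree" where
  "apply_upd t (Ins n t') =
     \<lparr> nodes = nodes t \<union> nodes t',
       edges = edges t \<union> edges t' \<union> {(n, root t')},
       lbl = (\<lambda>m. if m \<in> nodes t' then lbl t' m else lbl t m),
       root = root t,
       val = (\<lambda>m. if m \<in> nodes t' then val t' m else val t m) \<rparr>"
| "apply_upd t (Del n) =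
     (let K = nodes t - desc t n in
      \<lparr> nodes = K, edges = edges t \<inter> (K \<times> K), lbl = lbl t, root = root t, val = val t \<rparr>)"
| "apply_upd t (Rep n t') =
     (let K = nodes t - desc t n in
      \<lparr> nodes = K \<union> nodes t',
        edges = (edges t \<inter> (K \<times> K)) \<union> edges t' \<union> {(parent t n, root t')},
        lbl = (\<lambda>m. if m \<in> nodes t' then lbl t' m else lbl t m),
        root = root t,
        val = (\<lambda>m. if m \<in> nodes t' then val t' m else val t m) \<rparr>)"
| "apply_upd t (RepS n s) = t \<lparr> val := (val t)(n := s) \<rparr>"

fun valid_upd :: "('l, 'n) xtree \<Rightarrow> ('l, 'n) upd \<Rightarrow> bool" where
  "valid_upd t (Ins n t') = (n \<in> nodes t \<and> nodes t' \<inter> nodes t = {})"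
| "valid_upd t (Del n) = (n \<in> nodes t)"
| "valid_upd t (Rep n t') = (n \<in> nodes t \<and> nodes t' \<inter> nodes t = {})"
| "valid_upd t (RepS n s) = (n \<in> nodes t)"

definition apply_seq :: "('l, 'n) xtree \<Rightarrow> ('l, 'n) upd list \<Rightarrow> ('l, 'n) xtree" where
  "apply_seq t ops = foldl apply_upd t ops"

section \<open>Update access types\<close>

text \<open>UIns A B = (A, insert(B)); UDel A B = (A, delete(B)); URep A B B' = (A, replace(B,B'));
URepS A = (A, replace(str,str)).\<close>
datatype 'l uat = UIns 'l 'l | UDel 'l 'l | URep 'l 'l 'l | URepS 'l

fun uat_elem :: "'l uat \<Rightarrow> 'l" where
  "uat_elem (UIns A B) = A"
| "uat_elem (UDel A B) = A"
| "uat_elem (URep A B B') = A"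
| "uat_elem (URepS A) = A"

fun valid_uat :: "'l dtd \<Rightarrow> 'l uat \<Rightarrow> bool" where
  "valid_uat D (UIns A B) = (A \<in> Ele D \<and> Rg D A = RStar B)"
| "valid_uat D (UDel A B) = (A \<in> Ele D \<and> Rg D A = RStar B)"
| "valid_uat D (URep A B B') = (A \<in> Ele D \<and> B \<noteq> B' \<and>
     (\<exists>Bs. Rg D A = RDisj Bs \<and> B \<in> set Bs \<and> B' \<in> set Bs))"
| "valid_uat D (URepS A) = (A \<in> Ele D \<and> Rg D A = RStr)"

definition valid :: "'l dtd \<Rightarrow> 'l uat set" where
  "valid D = {u. valid_uat D u}"

fun matches :: "'l dtd \<Rightarrow> ('l, 'n) xtree \<Rightarrow> ('l, 'n) upd \<Rightarrow> 'l uat \<Rightarrow> bool" where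
  "matches D t (Ins n t') (UIns A B) = (lbl t n = El A \<and> t' \<in> I_D D B)"
| "matches D t (Del n) (UDel A B) =
     (lbl t n = El B \<and> has_parent t n \<and> lbl t (parent t n) = El A)"
| "matches D t (Rep n t') (URep A B B') =
     (lbl t n = El B \<and> has_parent t n \<and> lbl t (parent t n) = El A \<and> t' \<in> I_D D B' \<and> B \<noteq> B')"
| "matches D t (RepS n s) (URepS A) =
     (lbl t n = Str \<and> has_parent t n \<and> lbl t (parent t n) = El A)"
| "matches D t _ _ = False"

text \<open>[[S]]_t\<close>
definition sem :: "'l dtd \<Rightarrow> 'l uat set \<Rightarrow> ('l, 'n) xtree \<Rightarrow> ('l, 'n) upd set" where
  "sem D S t = {op. \<exists>u \<in> S. matches D t op u}"

fun allowed :: "'l dtd \<Rightarrow> 'l uat set \<Rightarrow> ('l, 'n) xtree \<Rightarrow> ('l, 'n) upd list \<Rightarrow> bool" where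
  "allowed D S t [] = True"
| "allowed D S t (op # ops) =
     (valid_upd t op \<and> op \<in> sem D S t \<and> allowed D S (apply_upd t op) ops)"

section \<open>Policies\<close>

type_synonym 'l policy = "'l uat set \<times> 'l uat set"

definition is_policy :: "'l dtd \<Rightarrow> 'l policy \<Rightarrow> bool" where
  "is_policy D P \<longleftrightarrow> fst P \<subseteq> valid D \<and> snd P \<subseteq> valid D \<and> fst P \<inter> snd P = {}"

definition total :: "'l dtd \<Rightarrow> 'l policy \<Rightarrow> bool" where
  "total D P \<longleftrightarrow> fst P \<union> snd P = valid D"

text \<open>Consistency; the node type 'n is the (fixed) universe of node identifiers.\<close>
definition consistent :: "'l dtd \<Rightarrow> 'l policy \<Rightarrow> 'n itself \<Rightarrow> bool" where
  "consistent D P (_ :: 'n itself) \<longleftrightarrow>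
     \<not> (\<exists>(t :: ('l, 'n) xtree) ops op0.
          t \<in> I_D D (rt D) \<and> ops \<noteq> [] \<and> allowed D (fst P) t ops
          \<and> op0 \<in> sem D (snd P) t \<and> valid_upd t op0
          \<and> \<not> iso (apply_upd t op0) t
          \<and> iso (apply_seq t ops) (apply_upd t op0))"

definition info_le :: "'l policy \<Rightarrow> 'l policy \<Rightarrow> bool" where
  "info_le P Q \<longleftrightarrow> fst P \<subseteq> fst Q \<and> snd P \<subseteq> snd Q"

definition quasiconsistent :: "'l dtd \<Rightarrow> 'l policy \<Rightarrow> 'n itself \<Rightarrow> bool" where
  "quasiconsistent D P N \<longleftrightarrow>
     (\<exists>Q. is_policy D Q \<and> total D Q \<and> info_le P Q \<and> consistent D Q N)"

section \<open>The operator T\<close>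

text \<open>Edges of G_A(S) for A with Rg(A) = B1+...+Bn.\<close>
definition G_A :: "'l dtd \<Rightarrow> 'l \<Rightarrow> 'l uat set \<Rightarrow> ('l \<times> 'l) set" where
  "G_A D A S = {(Bi, Bj). (\<exists>Bs. Rg D A = RDisj Bs \<and> Bi \<in> set Bs \<and> Bj \<in> set Bs)
                         \<and> URep A Bi Bj \<in> S}"

definition T_op :: "'l dtd \<Rightarrow> 'l uat set \<Rightarrow> 'l uat set" where
  "T_op D S = S
    \<union> {u \<in> valid D. \<exists>A B. A \<in> Ele D \<and> Rg D A = RStar B \<and> UIns A B \<in> S \<and> UDel A B \<in> S
                          \<and> (B, uat_elem u) \<in> le_D D}
    \<union> {u \<in> valid D. \<exists>A Bs Bi. A \<in> Ele D \<and> Rg D A = RDisj Bs \<and> Bi \<in> set Bs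
                          \<and> (Bi, Bi) \<in> (G_A D A S)\<^sup>+ \<and> (Bi, uat_elem u) \<in> le_D D}
    \<union> {URep A Bi Bk | A Bi Bk. \<exists>Bs. A \<in> Ele D \<and> Rg D A = RDisj Bs \<and> Bi \<in> set Bs
                          \<and> Bk \<in> set Bs \<and> Bi \<noteq> Bk \<and> (Bi, Bk) \<in> (G_A D A S)\<^sup>+}"

end

theory Submission
  imports Defs
begin

text \<open>For a UAT \<open>u\<close> in \<open>T(A) \<inter> F\<close>, a subtree is deleted and reinserted, or replaced along a
  path of \<open>G_A\<close>, in a tree built around it; the new subtree already carries the effect
  of the forbidden update.

  Conversely \<open>T\<close> is idempotent, so it suffices that a set \<open>S\<close> of allowed UATs with
  \<open>T(S) \<subseteq> S\<close> never simulates an update matching some \<open>u \<notin> S\<close>. Let \<open>C\<close> be the element type of \<open>u\<close>.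
  For each type \<open>A\<close> consider the multiset of labels (and string values) of the children of
  \<open>A\<close>-nodes, which is invariant under isomorphism. For \<open>A\<close> strictly above \<open>C\<close> it is the same
  at both ends of the simulation. Along a production above \<open>C\<close> closedness makes counts monotone:
  a star production allows insertions only or deletions only, and a subelement leading to \<open>C\<close> lies
  on no cycle of \<open>G_A\<close>. Monotone counts with equal ends are constant, so, going down from the root,
  no step changes the set of \<open>A\<close>-nodes for any \<open>A \<le> C\<close>. At the \<open>C\<close>-nodes themselves the allowed
  updates move a suitable count in one direction only, and the forbidden update moves it in
  the other.\<close>

section \<open>Trees\<close>

lemma is_treeD:
  assumes "is_tree t"
  shows "finite (nodes t)" "root t \<in> nodes t" "(p, n) \<in> edges t \<Longrightarrow> p \<in> nodes t"
    "(p, n) \<in> edges t \<Longrightarrow> n \<in> nodes t" "(p, root t) \<notin> edges t"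
    "n \<in> nodes t \<Longrightarrow> n \<noteq> root t \<Longrightarrow> \<exists>p. (p, n) \<in> edges t"
    "n \<in> nodes t \<Longrightarrow> (root t, n) \<in> (edges t)\<^sup>*"
  using assms unfolding is_tree_def by blast+

lemma parent_unique:
  assumes "is_tree t" "(p, n) \<in> edges t" "(q, n) \<in> edges t"
  shows "p = q"
proof -
  have "n \<in> nodes t" "n \<noteq> root t" using assms unfolding is_tree_def by blast+
  then show ?thesis using assms unfolding is_tree_def by blast
qed

lemma parent_eq: "is_tree t \<Longrightarrow> (p, n) \<in> edges t \<Longrightarrow> parent t n = p"
  unfolding parent_def by (blast intro: parent_unique)

lemma has_parentD:
  assumes "is_tree t" "has_parent t n"
  shows "(parent t n, n) \<in> edges t" "n \<noteq> root t" "n \<in> nodes t" "parent t n \<in> nodes t"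
  using assms parent_eq is_treeD unfolding has_parent_def by metis+

text \<open>Acyclicity is not among the axioms in \<open>is_tree\<close>. By uniqueness of parents a
  cycle through a node also passes through its parent, so it could be pushed up along the path from
  the root to the root itself, which has no incoming edge.\<close>

lemma tree_acyclic:
  assumes t: "is_tree t"
  shows "(n, n) \<notin> (edges t)\<^sup>+"
proof
  assume c: "(n, n) \<in> (edges t)\<^sup>+"
  then have "n \<in> nodes t" by (meson is_treeD(4)[OF t] tranclE)
  then have "(root t, n) \<in> (edges t)\<^sup>*" using is_treeD[OF t] by blast
  then show False using c
  proof (induction rule: rtrancl_induct)
    case base
    then show ?case by (meson is_treeD(5)[OF t] tranclE)
  next
    case (step p n)
    from step.prems obtain q where q: "(n, q) \<in> (edges t)\<^sup>*" "(q, n) \<in> edges t"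
      by (meson tranclD2)
    with step.hyps parent_unique[OF t] have "q = p" by blast
    with q step.hyps have "(p, p) \<in> (edges t)\<^sup>+" by (meson rtrancl_into_trancl2)
    then show ?case by (rule step.IH)
  qed
qed

lemma desc_self: "n \<in> desc t n"
  by (simp add: desc_def)

lemma desc_step: "m \<in> desc t n \<Longrightarrow> (m, k) \<in> edges t \<Longrightarrow> k \<in> desc t n"
  unfolding desc_def by (auto intro: rtrancl_into_rtrancl)

text \<open>The path from \<open>n\<close> to \<open>m\<close> is nonempty because \<open>m\<close>
  differs from \<open>n\<close>, and by uniqueness of parents its last edge starts at
  \<open>q\<close>.\<close>

lemma desc_back:
  assumes "is_tree t" "m \<in> desc t n" "(q, m) \<in> edges t" "m \<noteq> n"
  shows "q \<in> desc t n"
proof -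
  have "(n, m) \<in> (edges t)\<^sup>*" using assms(2) by (simp add: desc_def)
  then obtain r where "(n, r) \<in> (edges t)\<^sup>*" "(r, m) \<in> edges t"
    using assms(4) by (metis rtranclE)
  then show ?thesis using parent_unique[OF assms(1) assms(3)] by (auto simp: desc_def)
qed

lemma root_notin_desc:
  assumes "is_tree t" "n \<noteq> root t"
  shows "root t \<notin> desc t n"
  using assms is_treeD(5)[OF assms(1)] unfolding desc_def by (auto elim: rtranclE)

lemma parent_notin_desc:
  assumes "is_tree t" "(p, n) \<in> edges t"
  shows "p \<notin> desc t n"
  using tree_acyclic[OF assms(1)] assms(2) unfolding desc_def
  by (auto dest: rtrancl_into_trancl1)

lemma desc_subset_nodes: "is_tree t \<Longrightarrow> n \<in> nodes t \<Longrightarrow> desc t n \<subseteq> nodes t"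
proof
  fix m assume t: "is_tree t" "n \<in> nodes t" "m \<in> desc t n"
  from t(3) have "(n, m) \<in> (edges t)\<^sup>*" by (simp add: desc_def)
  then show "m \<in> nodes t" by (induction) (simp_all add: t is_treeD(4)[OF t(1)])
qed

lemma finite_children: "is_tree t \<Longrightarrow> finite (children t n)"
  by (rule finite_subset[of _ "nodes t"]) (auto simp: children_def is_treeD)

lemma mem_child_labels: "is_tree t \<Longrightarrow> (n, m) \<in> edges t \<Longrightarrow> lbl t m \<in># child_labels t n"
  using finite_children[of t n] by (auto simp: child_labels_def children_def)

lemma child_labels_cong:
  "children t n = children t' n \<Longrightarrow> (\<And>m. m \<in> children t n \<Longrightarrow> lbl t m = lbl t' m) \<Longrightarrow>
   child_labels t n = child_labels t' n"
  unfolding child_labels_def by (metis (mono_tags, lifting) elem_mset_set empty_iff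
      image_mset_cong infinite_set_mset_mset_set set_mset_empty)

section \<open>Updates and the structure of trees\<close>

text \<open>All later facts on \<open>Rep\<close> are reduced to \<open>Del\<close> and
  \<open>Ins\<close> this way. The parent is read off before the deletion; as \<open>Del\<close>
  leaves \<open>lbl\<close> and \<open>val\<close> alone everywhere, both sides are equal and not
  merely isomorphic.\<close>

lemma Rep_eq_Del_Ins:
  "apply_upd t (Rep n s) = apply_upd (apply_upd t (Del n)) (Ins (parent t n) s)"
  by (simp add: Let_def fun_eq_iff)

lemma nodes_Del: "nodes (apply_upd t (Del n)) = nodes t - desc t n"
  and edges_Del: "edges (apply_upd t (Del n)) =
    edges t \<inter> ((nodes t - desc t n) \<times> (nodes t - desc t n))"
  and lbl_Del: "lbl (apply_upd t (Del n)) = lbl t"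
  and val_Del: "val (apply_upd t (Del n)) = val t"
  and root_Del: "root (apply_upd t (Del n)) = root t"
  by (simp_all add: Let_def)

lemmas Del_sels = nodes_Del edges_Del lbl_Del val_Del root_Del

declare apply_upd.simps(2,3) [simp del] Del_sels [simp]

lemma is_tree_Ins:
  assumes t: "is_tree t" and s: "is_tree s" and p: "p \<in> nodes t"
    and disj: "nodes s \<inter> nodes t = {}"
  shows "is_tree (apply_upd t (Ins p s))"
proof -
  let ?E = "edges t \<union> edges s \<union> {(p, root s)}"
  note T = is_treeD[OF t] and S = is_treeD[OF s]
  have reach_t: "(root t, n) \<in> ?E\<^sup>*" if "n \<in> nodes t" for n
    using T(7)[OF that] by (rule rtrancl_mono[THEN subsetD, rotated]) blast
  have reach_s: "(root t, n) \<in> ?E\<^sup>*" if "n \<in> nodes s" for n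
  proof -
    have "(root s, n) \<in> ?E\<^sup>*"
      using S(7)[OF that] by (rule rtrancl_mono[THEN subsetD, rotated]) blast
    moreover have "(root t, root s) \<in> ?E\<^sup>*"
      using reach_t[OF p] by (rule rtrancl_into_rtrancl) blast
    ultimately show ?thesis by (meson rtrancl_trans)
  qed
  have up: "\<exists>!q. (q, n) \<in> ?E" if nts: "n \<in> nodes t \<union> nodes s" "n \<noteq> root t" for n
  proof (cases "n \<in> nodes t")
    case True
    then obtain q where q: "(q, n) \<in> edges t" using T(6)[of n] nts by blast
    have "n \<notin> nodes s" using True disj by blast
    then have "(q', n) \<in> edges t" if "(q', n) \<in> ?E" for q'
      using that S(2) S(4)[of q' n] by blast
    then have "(q', n) \<in> ?E \<Longrightarrow> q' = q" for q'
      using parent_unique[OF t q] by blast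
    with q show ?thesis by blast
  next
    case False
    then have n: "n \<in> nodes s" using nts by blast
    show ?thesis
    proof (cases "n = root s")
      case True
      then show ?thesis using S(5) False T(4)[of _ n] by blast
    next
      case ne: False
      then obtain q where q: "(q, n) \<in> edges s" using S(6)[OF n] by blast
      have "(q', n) \<in> edges s" if "(q', n) \<in> ?E" for q'
        using that False ne T(4)[of q' n] by blast
      then have "(q', n) \<in> ?E \<Longrightarrow> q' = q" for q'
        using parent_unique[OF s q] by blast
      with q show ?thesis by blast
    qed
  qed
  show ?thesis
    unfolding is_tree_def
  proof (intro conjI ballI impI allI)
    fix q show "(q, root (apply_upd t (Ins p s))) \<notin> edges (apply_upd t (Ins p s))"
      using T(2,5) S(2) S(4)[of q "root t"] disj by auto
  qed (use T(1,2,3,4) S(1,2,3,4) p reach_t reach_s up in auto)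
qed

lemma is_tree_Del:
  assumes t: "is_tree t" and n: "n \<noteq> root t"
  shows "is_tree (apply_upd t (Del n))"
proof -
  let ?K = "nodes t - desc t n"
  let ?E = "edges t \<inter> (?K \<times> ?K)"
  note T = is_treeD[OF t]
  \<comment> \<open>The survivors are closed under parents, so the path from the root to a survivor
    survives as a whole.\<close>
  have K: "p \<in> ?K" if "(p, m) \<in> edges t" "m \<in> ?K" for p m
    using that desc_step[of p t n m] T(3) by blast
  have up: "\<exists>!q. (q, m) \<in> ?E" if "m \<in> ?K" "m \<noteq> root t" for m
    using K[of _ m] that T(6)[of m] parent_unique[OF t] by blast
  have reach: "(root t, m) \<in> ?E\<^sup>*" if "m \<in> ?K" for m
  proof -
    have "(root t, m) \<in> (edges t)\<^sup>*" using that T(7) by blast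
    then show ?thesis using that
    proof (induction rule: rtrancl_induct)
      case (step y z)
      then show ?case using K[of y z] by (auto intro: rtrancl_into_rtrancl)
    qed simp
  qed
  show ?thesis
    unfolding is_tree_def Del_sels
    using T(1,2,5) root_notin_desc[OF t n] up reach by auto
qed

lemma children_Ins:
  assumes "is_tree t" "is_tree s" "p \<in> nodes t" "nodes s \<inter> nodes t = {}"
  shows "children (apply_upd t (Ins p s)) q =
    (if q = p then insert (root s) (children t p)
     else if q \<in> nodes s then children s q else children t q)"
proof -
  have "(q, m) \<in> edges t \<Longrightarrow> q \<notin> nodes s" "(q, m) \<in> edges s \<Longrightarrow> q \<in> nodes s" for m
    using assms is_treeD(3)[of t q m] is_treeD(3)[of s q m] by blast+
  moreover have "p \<notin> nodes s" using assms by blast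
  ultimately show ?thesis by (auto simp: children_def)
qed

lemma child_labels_Ins:
  assumes "is_tree t" "is_tree s" "p \<in> nodes t" "nodes s \<inter> nodes t = {}"
  shows "child_labels (apply_upd t (Ins p s)) q =
    (if q = p then add_mset (lbl s (root s)) (child_labels t p)
     else if q \<in> nodes s then child_labels s q else child_labels t q)"
proof -
  note ch = children_Ins[OF assms]
  have ct: "m \<in> children t q' \<Longrightarrow> m \<in> nodes t \<and> m \<notin> nodes s" for m q'
    using assms is_treeD(4)[of t q' m] by (auto simp: children_def)
  have cs: "m \<in> children s q' \<Longrightarrow> m \<in> nodes s" for m q'
    using assms is_treeD(4)[of s q' m] by (auto simp: children_def)
  have rs: "root s \<in> nodes s" "root s \<notin> children t p"
    using assms is_treeD(2)[of s] ct by blast+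
  consider "q = p" | "q \<noteq> p" "q \<in> nodes s" | "q \<noteq> p" "q \<notin> nodes s" by blast
  then show ?thesis
  proof cases
    case 1
    have "image_mset (\<lambda>m. if m \<in> nodes s then lbl s m else lbl t m) (mset_set (children t p)) =
      image_mset (lbl t) (mset_set (children t p))"
      using ct finite_children[OF assms(1)] by (intro image_mset_cong) auto
    with 1 rs finite_children[OF assms(1)] show ?thesis
      unfolding child_labels_def ch by simp
  next
    case 2
    then show ?thesis using ch cs by (auto intro!: child_labels_cong)
  next
    case 3
    then show ?thesis using ch ct by (auto intro!: child_labels_cong)
  qed
qed

lemma children_Del:
  assumes "is_tree t" "(p, n) \<in> edges t" "q \<in> nodes t - desc t n"
  shows "children (apply_upd t (Del n)) q = (if q = p then children t p - {n} else children t q)"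
proof -
  have "m \<in> desc t n \<longleftrightarrow> m = n" if "(q, m) \<in> edges t" for m
    using that assms desc_back[OF assms(1) _ that] desc_self by auto
  moreover have "(q, n) \<in> edges t \<longleftrightarrow> q = p"
    using assms parent_unique by metis
  ultimately show ?thesis
    using assms is_treeD(4)[OF assms(1)] unfolding children_def Del_sels by auto
qed

text \<open>The old multiset is expressed through the new one, so that the lost label appears in an
  \<open>add_mset\<close> rather than in a multiset difference.\<close>

lemma child_labels_Del:
  assumes "is_tree t" "(p, n) \<in> edges t" "q \<in> nodes t - desc t n"
  shows "child_labels t q = (if q = p
    then add_mset (lbl t n) (child_labels (apply_upd t (Del n)) p)
    else child_labels (apply_upd t (Del n)) q)"
proof -
  have "children t p = insert n (children t p - {n})"
    using assms by (auto simp: children_def)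
  then have "mset_set (children t p) = add_mset n (mset_set (children t p - {n}))"
    using finite_children[OF assms(1), of p]
    by (metis Diff_iff finite_Diff insertI1 mset_set.insert)
  then show ?thesis
    using children_Del[OF assms] unfolding child_labels_def Del_sels by auto
qed

section \<open>Conformance up to holes\<close>

text \<open>The content model of the nodes in \<open>H\<close> is not checked, so that a conforming tree can be
  edited or built one child at a time. The root label may be \<^const>\<open>Str\<close>, which covers the
  one-node tree below an element with content \<^const>\<open>RStr\<close>.\<close>

definition pconf :: "'l dtd \<Rightarrow> 'l lab \<Rightarrow> 'n set \<Rightarrow> ('l, 'n) xtree \<Rightarrow> bool" where
  "pconf D X H t \<longleftrightarrow> is_tree t \<and> lbl t (root t) = X
     \<and> (\<forall>n \<in> nodes t. lbl t n \<in> El ` Ele D \<union> {Str})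
     \<and> (\<forall>n \<in> nodes t - H. \<forall>B. lbl t n = El B \<longrightarrow> lang_ok (Rg D B) (child_labels t n))
     \<and> (\<forall>n \<in> nodes t. lbl t n = Str \<longrightarrow> children t n = {})"

lemma conforms_iff_pconf: "conforms D A t \<longleftrightarrow> pconf D (El A) {} t"
  by (simp add: conforms_def pconf_def)

lemma pconf_mono: "pconf D X H t \<Longrightarrow> H \<subseteq> H' \<Longrightarrow> pconf D X H' t"
  unfolding pconf_def by blast

lemma pconf_is_tree: "pconf D X H t \<Longrightarrow> is_tree t"
  by (simp add: pconf_def)

lemma conforms_is_tree: "conforms D A t \<Longrightarrow> is_tree t"
  by (simp add: conforms_def)

lemma conforms_close:
  assumes "pconf D (El R) {p} t" "lbl t p = El A" "lang_ok (Rg D A) (child_labels t p)"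
  shows "conforms D R t"
  using assms unfolding conforms_def pconf_def by auto

lemma pconf_close:
  assumes "pconf D X (insert p H) t" "lbl t p = El A" "lang_ok (Rg D A) (child_labels t p)"
  shows "pconf D X H t"
  using assms unfolding pconf_def by auto

text \<open>Only the content of \<open>p\<close> changes among the old nodes, hence \<open>p\<close>
  has to be a hole. It must not be labelled \<open>Str\<close>, because such nodes stay leaves even
  when they are holes.\<close>

lemma pconf_Ins:
  assumes t: "pconf D X H t" and s: "pconf D Y H' s" and p: "p \<in> nodes t" "p \<in> H"
    and pl: "lbl t p \<noteq> Str" and disj: "nodes s \<inter> nodes t = {}"
  shows "pconf D X (H \<union> H') (apply_upd t (Ins p s))"
proof -
  have T: "is_tree t" "is_tree s" using t s pconf_is_tree by blast+
  note ch = children_Ins[OF T p(1) disj] and cl = child_labels_Ins[OF T p(1) disj]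
  have "root t \<notin> nodes s" using is_treeD(2)[OF T(1)] disj by blast
  then show ?thesis
    using t s is_tree_Ins[OF T p(1) disj] p pl disj
    unfolding pconf_def ch cl by auto
qed

lemma pconf_Del:
  assumes t: "pconf D X H t" and e: "(p, n) \<in> edges t" and p: "p \<in> H"
  shows "pconf D X H (apply_upd t (Del n))"
proof -
  have T: "is_tree t" using t pconf_is_tree by blast
  have n: "n \<noteq> root t" using e is_treeD(5)[OF T] by blast
  note ch = children_Del[OF T e] and cl = child_labels_Del[OF T e]
  have "lang_ok (Rg D B) (child_labels (apply_upd t (Del n)) q)"
    if "q \<in> nodes t - desc t n" "q \<notin> H" "lbl t q = El B" for q B
  proof -
    have "q \<noteq> p" using that p by blast
    then show ?thesis using t that cl[OF that(1)] unfolding pconf_def by force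
  qed
  moreover have "children (apply_upd t (Del n)) q = {}"
    if "q \<in> nodes t - desc t n" "lbl t q = Str" for q
    using t that ch[OF that(1)] unfolding pconf_def by auto
  ultimately show ?thesis
    using t is_tree_Del[OF T n] unfolding pconf_def Del_sels by auto
qed

section \<open>Element types along the edges of a conforming tree\<close>

lemma lang_ok_subelems: "lang_ok r M \<Longrightarrow> El B \<in># M \<Longrightarrow> B \<in> subelems r"
  by (cases r) auto

text \<open>A node with a child cannot be labelled \<open>Str\<close>, so its label is an element
  type and a content model applies.\<close>

lemma conforms_edge:
  assumes c: "conforms D R t" and e: "(p, n) \<in> edges t"
  obtains A where "A \<in> Ele D" "lbl t p = El A" "lang_ok (Rg D A) (child_labels t p)"
    "lbl t n \<in># child_labels t p"
proof -
  have T: "is_tree t" using c by (simp add: conforms_def)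
  have p: "p \<in> nodes t" "children t p \<noteq> {}" using e is_treeD[OF T] by (auto simp: children_def)
  then obtain A where "lbl t p = El A" "A \<in> Ele D" using c unfolding conforms_def by blast
  then show ?thesis using that p c mem_child_labels[OF T e] unfolding conforms_def by blast
qed

lemma conforms_sub_rel:
  assumes c: "conforms D R t" and e: "(p, n) \<in> edges t" and n: "lbl t n = El B"
  obtains A where "lbl t p = El A" "(A, B) \<in> sub_rel D"
  using conforms_edge[OF c e] n lang_ok_subelems unfolding sub_rel_def
  by (metis (mono_tags, lifting) CollectI case_prodI)

lemma conforms_le_D:
  assumes c: "conforms D R t" and r: "(n, m) \<in> (edges t)\<^sup>*"
    and n: "lbl t n = El A" and m: "lbl t m = El B"
  shows "(A, B) \<in> le_D D"
  using r m
proof (induction arbitrary: B rule: rtrancl_induct)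
  case base
  then show ?case using n by (simp add: le_D_def)
next
  case (step p m)
  from conforms_sub_rel[OF c step.hyps(2) step.prems]
  obtain C where "lbl t p = El C" "(C, B) \<in> sub_rel D" by blast
  with step.IH show ?case unfolding le_D_def by (blast intro: rtrancl_into_rtrancl)
qed

lemma conforms_root_le_D:
  assumes "conforms D A t" "n \<in> nodes t" "lbl t n = El B"
  shows "(A, B) \<in> le_D D"
  using conforms_le_D[OF assms(1) is_treeD(7) _ assms(3)] assms
  unfolding conforms_def by blast

section \<open>Updates matching valid UATs preserve conformance\<close>

lemma matches_cases:
  assumes "matches D t op v"
  obtains (Ins) n s A B where "op = Ins n s" "v = UIns A B" "lbl t n = El A" "conforms D B s"
  | (Del) n A B where "op = Del n" "v = UDel A B" "lbl t n = El B" "has_parent t n"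
      "lbl t (parent t n) = El A"
  | (Rep) n s A B B' where "op = Rep n s" "v = URep A B B'" "lbl t n = El B" "has_parent t n"
      "lbl t (parent t n) = El A" "conforms D B' s" "B \<noteq> B'"
  | (RepS) n x A where "op = RepS n x" "v = URepS A" "lbl t n = Str" "has_parent t n"
      "lbl t (parent t n) = El A"
  using assms by (cases op; cases v) (auto simp: I_D_def)

text \<open>For insertion, deletion and subtree replacement, the only content to recheck is that of
  the parent node, which is opened as a hole, edited and closed again: star content survives adding
  or removing a \<open>B\<close>, and a disjunction survives the exchange of its single
  child.\<close>

lemma conforms_apply_upd:
  assumes c: "conforms D R t" and v: "v \<in> valid D" and m: "matches D t op v"
    and va: "valid_upd t op"
  shows "conforms D R (apply_upd t op)"
proof -
  have T: "is_tree t" using c by (simp add: conforms_def)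
  have pc: "pconf D (El R) {p} t" for p
    using c pconf_mono unfolding conforms_iff_pconf by blast
  have lang: "lang_ok (Rg D A) (child_labels t p)" if "p \<in> nodes t" "lbl t p = El A" for p A
    using c that unfolding conforms_def by blast
  from m show ?thesis
  proof (cases rule: matches_cases)
    case (Ins n s A B)
    then have n: "n \<in> nodes t" "nodes s \<inter> nodes t = {}" using va by auto
    have s: "pconf D (El B) {} s" using Ins by (simp add: conforms_iff_pconf)
    then have ls: "lbl s (root s) = El B" by (simp add: pconf_def)
    have "pconf D (El R) {n} (apply_upd t (Ins n s))"
      using pconf_Ins[OF pc[of n] s n(1) _ _ n(2)] Ins by simp
    moreover have "lang_ok (Rg D A) (child_labels (apply_upd t (Ins n s)) n)"
      using lang[OF n(1) Ins(3)] v Ins(2) ls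
      unfolding child_labels_Ins[OF T pconf_is_tree[OF s] n] by (auto simp: valid_def)
    moreover have "lbl (apply_upd t (Ins n s)) n = El A" using n Ins by auto
    ultimately show ?thesis unfolding Ins(1) by (intro conforms_close)
  next
    case (Del n A B)
    let ?p = "parent t n"
    note hp = has_parentD[OF T Del(4)]
    have K: "?p \<in> nodes t - desc t n" using hp parent_notin_desc[OF T hp(1)] by blast
    have "lang_ok (Rg D A) (child_labels (apply_upd t (Del n)) ?p)"
      using lang[OF hp(4) Del(5)] v Del(2) child_labels_Del[OF T hp(1) K]
      by (auto simp: valid_def)
    moreover have "pconf D (El R) {?p} (apply_upd t (Del n))"
      using pconf_Del[OF pc hp(1)] by simp
    ultimately show ?thesis unfolding Del(1) using Del(5) by (intro conforms_close) simp_all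
  next
    case (Rep n s A B B')
    let ?p = "parent t n" and ?t = "apply_upd t (Del n)"
    note hp = has_parentD[OF T Rep(4)]
    have K: "?p \<in> nodes ?t" using hp parent_notin_desc[OF T hp(1)] by (simp add: nodes_Del)
    have d: "nodes s \<inter> nodes ?t = {}" using va Rep(1) by (auto simp: nodes_Del)
    have s: "pconf D (El B') {} s" using Rep by (simp add: conforms_iff_pconf)
    then have ls: "lbl s (root s) = El B'" by (simp add: pconf_def)
    have pt: "pconf D (El R) {?p} ?t"
      using pconf_Del[OF pc hp(1)] by simp
    have "pconf D (El R) {?p} (apply_upd ?t (Ins ?p s))"
      using pconf_Ins[OF pt s K _ _ d] Rep by (simp add: lbl_Del)
    \<comment> \<open>A replacement is valid only below a disjunction, so \<open>n\<close> was the
      only child and its deletion leaves none.\<close>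
    moreover have "child_labels ?t ?p = {#}"
    proof -
      obtain Bs where "Rg D A = RDisj Bs" using v Rep(2) by (auto simp: valid_def)
      then show ?thesis
        using lang[OF hp(4) Rep(5)] child_labels_Del[OF T hp(1)] K
        by (auto simp: nodes_Del)
    qed
    then have "lang_ok (Rg D A) (child_labels (apply_upd ?t (Ins ?p s)) ?p)"
      using v Rep(2) ls
      unfolding child_labels_Ins[OF pconf_is_tree[OF pt] pconf_is_tree[OF s] K d]
      by (auto simp: valid_def)
    moreover have "lbl (apply_upd ?t (Ins ?p s)) ?p = El A"
      using K d Rep lbl_Del[of t n] by auto
    ultimately show ?thesis unfolding Rep(1) Rep_eq_Del_Ins by (intro conforms_close)
  next
    case (RepS n x A)
    have "is_tree (apply_upd t op)" using T RepS by (simp add: is_tree_def)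
    then show ?thesis using c RepS by (simp add: conforms_def child_labels_def children_def)
  qed
qed

section \<open>Invariants of trees\<close>

definition pop :: "('l, 'n) xtree \<Rightarrow> 'l \<Rightarrow> 'n set" where
  "pop t A = {n \<in> nodes t. lbl t n = El A}"

text \<open>Values at element nodes carry no meaning, hence are masked.\<close>

definition key :: "('l, 'n) xtree \<Rightarrow> 'n \<Rightarrow> 'l lab \<times> string" where
  "key t n = (lbl t n, if lbl t n = Str then val t n else [])"

text \<open>Node identities are kept so that consecutive trees of a run can be compared node by
  node; \<open>profile\<close> forgets them and thereby becomes invariant under isomorphism.\<close>

definition kids :: "('l, 'n) xtree \<Rightarrow> 'l \<Rightarrow> ('n \<times> 'l lab \<times> string) set" where
  "kids t A = {(n, key t n) | n. \<exists>p. (p, n) \<in> edges t \<and> lbl t p = El A}"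

definition profile :: "('l, 'n) xtree \<Rightarrow> 'l \<Rightarrow> ('l lab \<times> string) multiset" where
  "profile t A = image_mset snd (mset_set (kids t A))"

lemma mem_kids: "(n, k) \<in> kids t A \<longleftrightarrow> k = key t n \<and> (\<exists>p. (p, n) \<in> edges t \<and> lbl t p = El A)"
  by (auto simp: kids_def)

lemma finite_kids:
  assumes "is_tree t"
  shows "finite (kids t A)"
proof (rule finite_subset)
  show "kids t A \<subseteq> (\<lambda>n. (n, key t n)) ` nodes t"
    using is_treeD(4)[OF assms] by (auto simp: kids_def)
qed (simp add: is_treeD(1)[OF assms])

text \<open>An isomorphism carries the kids bijectively and preserves their keys. The masking in
  \<open>key\<close> matters here, since \<open>iso\<close> compares values at \<open>Str\<close>
  nodes only.\<close>

lemma profile_cong_iso: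
  assumes t: "is_tree t" and u: "is_tree u" and i: "iso t u"
  shows "profile u A = profile t A"
proof -
  obtain f where f: "bij_betw f (nodes t) (nodes u)"
    and e: "\<And>a b. a \<in> nodes t \<Longrightarrow> b \<in> nodes t \<Longrightarrow> (a, b) \<in> edges t \<longleftrightarrow> (f a, f b) \<in> edges u"
    and l: "\<And>a. a \<in> nodes t \<Longrightarrow> lbl u (f a) = lbl t a"
    and v: "\<And>a. a \<in> nodes t \<Longrightarrow> lbl t a = Str \<Longrightarrow> val u (f a) = val t a"
    using i unfolding iso_def by blast
  have k: "key u (f a) = key t a" if "a \<in> nodes t" for a
    using l[OF that] v[OF that] by (auto simp: key_def)
  let ?g = "map_prod f id"
  have sub: "fst x \<in> nodes t" if "x \<in> kids t A" for x
    using that is_treeD(4)[OF t] by (auto simp: kids_def)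
  have inj: "inj_on ?g (kids t A)"
  proof (rule inj_onI)
    fix x y assume "x \<in> kids t A" "y \<in> kids t A" "?g x = ?g y"
    then have "f (fst x) = f (fst y)" "snd x = snd y" "fst x \<in> nodes t" "fst y \<in> nodes t"
      using sub by (auto simp: map_prod_def split: prod.splits)
    then show "x = y" using f by (auto simp: bij_betw_def prod_eq_iff dest: inj_onD)
  qed
  have img: "kids u A = ?g ` kids t A"
  proof (intro equalityI subsetI)
    fix x assume "x \<in> kids u A"
    then obtain p n where x: "x = (n, key u n)" "(p, n) \<in> edges u" "lbl u p = El A"
      by (auto simp: kids_def)
    then have "p \<in> f ` nodes t" "n \<in> f ` nodes t"
      using f is_treeD(3,4)[OF u] unfolding bij_betw_def by auto
    then obtain p' n' where "p = f p'" "p' \<in> nodes t" "n = f n'" "n' \<in> nodes t" by blast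
    then have "(n', key t n') \<in> kids t A" "x = ?g (n', key t n')"
      using x e l k by (auto simp: mem_kids)
    then show "x \<in> ?g ` kids t A" by blast
  next
    fix x assume "x \<in> ?g ` kids t A"
    then obtain p n where x: "x = (f n, key t n)" "(p, n) \<in> edges t" "lbl t p = El A"
      by (auto simp: kids_def)
    then have "p \<in> nodes t" "n \<in> nodes t" using is_treeD(3,4)[OF t] by blast+
    then show "x \<in> kids u A" using x e l k by (auto simp: mem_kids)
  qed
  show ?thesis
    unfolding profile_def img image_mset_mset_set[OF inj, symmetric]
    by (simp add: image_mset.compositionality comp_def)
qed

section \<open>Effect of updates on the invariants\<close>

lemma pop_Ins:
  "pop (apply_upd t (Ins p s)) A = (pop t A - nodes s) \<union> pop s A"
  by (auto simp: pop_def)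

lemma pop_Del: "pop (apply_upd t (Del n)) A = pop t A - desc t n"
  by (auto simp: pop_def)

text \<open>Without an \<open>A\<close>-node inside \<open>s\<close>, the root of \<open>s\<close>
  is the only possible new child of an \<open>A\<close>-node.\<close>

lemma kids_Ins:
  assumes t: "is_tree t" and s: "is_tree s" and p: "p \<in> nodes t"
    and disj: "nodes s \<inter> nodes t = {}" and ps: "pop s A = {}"
  shows "kids (apply_upd t (Ins p s)) A =
    (if lbl t p = El A then insert (root s, key s (root s)) (kids t A) else kids t A)"
proof -
  let ?u = "apply_upd t (Ins p s)"
  have ks: "key ?u n = key s n" if "n \<in> nodes s" for n using that by (simp add: key_def)
  have kt: "key ?u n = key t n" if "n \<in> nodes t" for n
    using that disj by (auto simp: key_def)
  have lt: "lbl ?u n = lbl t n" if "n \<in> nodes t" for n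
    using that disj by auto
  have ls: "lbl ?u n \<noteq> El A" if "n \<in> nodes s" for n
    using that ps by (auto simp: pop_def)
  have E: "edges ?u = edges t \<union> edges s \<union> {(p, root s)}" by simp
  show ?thesis
  proof (intro set_eqI)
    fix x :: "'b \<times> 'a lab \<times> string"
    obtain n k where x: "x = (n, k)" using surj_pair[of x] by blast
    have "x \<in> kids ?u A \<longleftrightarrow> k = key ?u n \<and> ((\<exists>q. (q, n) \<in> edges t \<and> lbl t q = El A)
        \<or> (n = root s \<and> lbl t p = El A))"
      unfolding x mem_kids E
      by (auto simp del: apply_upd.simps simp: lt[OF p] lt[OF is_treeD(3)[OF t]]
          dest: ls[OF is_treeD(3)[OF s]])
    also have "\<dots> \<longleftrightarrow> (k = key t n \<and> (\<exists>q. (q, n) \<in> edges t \<and> lbl t q = El A))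
        \<or> (k = key s n \<and> n = root s \<and> lbl t p = El A)"
      using kt[OF is_treeD(4)[OF t]] ks[OF is_treeD(2)[OF s]] by metis
    finally show "x \<in> kids ?u A \<longleftrightarrow> x \<in> (if lbl t p = El A
        then insert (root s, key s (root s)) (kids t A) else kids t A)"
      unfolding x by (auto simp: mem_kids)
  qed
qed

lemma profile_Ins:
  assumes "is_tree t" "is_tree s" "p \<in> nodes t" "nodes s \<inter> nodes t = {}" "pop s A = {}"
    and "lbl t p = El A"
  shows "profile (apply_upd t (Ins p s)) A = add_mset (key s (root s)) (profile t A)"
proof -
  have "root s \<notin> nodes t" using assms is_treeD(2)[of s] by blast
  then have "(root s, key s (root s)) \<notin> kids t A"
    using is_treeD(4)[OF assms(1)] by (auto simp: mem_kids)
  then show ?thesis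
    using kids_Ins[OF assms(1-5)] assms(6) finite_kids[OF assms(1)]
    unfolding profile_def by simp
qed

text \<open>No \<open>A\<close>-node lies in the deleted subtree, so an edge out of an
  \<open>A\<close>-node is lost only if it leads to \<open>n\<close> itself.\<close>

lemma kids_Del:
  assumes t: "is_tree t" and e: "(p, n) \<in> edges t"
    and pop: "pop t A \<inter> desc t n = {}"
  shows "kids t A =
    (if lbl t p = El A then insert (n, key t n) (kids (apply_upd t (Del n)) A)
     else kids (apply_upd t (Del n)) A)"
    and "(n, k) \<notin> kids (apply_upd t (Del n)) A"
proof -
  let ?u = "apply_upd t (Del n)"
  have k: "key ?u m = key t m" for m by (simp add: key_def)
  have E: "(q, m) \<in> edges ?u \<longleftrightarrow> (q, m) \<in> edges t \<and> m \<noteq> n" if "lbl t q = El A" for q m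
  proof -
    have "q \<in> nodes t - desc t n" if "(q, m) \<in> edges t"
      using that \<open>lbl t q = El A\<close> pop is_treeD(3)[OF t that] by (auto simp: pop_def)
    then have "children (apply_upd t (Del n)) q = children t q - {n}" if "(q, m) \<in> edges t"
      using that children_Del[OF t e, of q] parent_unique[OF t e, of q]
      by (auto simp: children_def)
    moreover have "m \<in> children (apply_upd t (Del n)) q \<Longrightarrow> (q, m) \<in> edges t"
      by (simp add: children_def)
    ultimately show ?thesis by (auto simp: children_def simp del: edges_Del)
  qed
  have l: "lbl ?u = lbl t" by simp
  have un: "(q, n) \<in> edges t \<longleftrightarrow> q = p" for q using e parent_unique[OF t e] by blast
  have mem: "(m, k) \<in> kids ?u A \<longleftrightarrow> (m, k) \<in> kids t A \<and> m \<noteq> n" for m k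
    unfolding mem_kids l k using E by blast
  then show "(n, k) \<notin> kids ?u A" by blast
  have "(n, k) \<in> kids t A \<longleftrightarrow> k = key t n \<and> lbl t p = El A" for k
    unfolding mem_kids un by blast
  then show "kids t A = (if lbl t p = El A then insert (n, key t n) (kids ?u A) else kids ?u A)"
    using mem by (auto simp: set_eq_iff)
qed

lemma profile_Del:
  assumes t: "is_tree t" and e: "(p, n) \<in> edges t" and pop: "pop t A \<inter> desc t n = {}"
    and p: "lbl t p = El A"
  shows "profile t A = add_mset (key t n) (profile (apply_upd t (Del n)) A)"
proof -
  have "n \<noteq> root t" using e is_treeD(5)[OF t] by blast
  then have "finite (kids (apply_upd t (Del n)) A)" by (intro finite_kids is_tree_Del t)
  then show ?thesis
    using kids_Del[OF t e pop] p unfolding profile_def by simp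
qed

lemma profile_RepS:
  assumes t: "is_tree t" and e: "(p, n) \<in> edges t" and n: "lbl t n = Str"
  shows "lbl t p \<noteq> El A \<Longrightarrow> kids (apply_upd t (RepS n x)) A = kids t A"
    and "lbl t p = El A \<Longrightarrow> \<exists>N. profile t A = add_mset (Str, val t n) N \<and>
      profile (apply_upd t (RepS n x)) A = add_mset (Str, x) N"
proof -
  let ?u = "apply_upd t (RepS n x)"
  have un: "(q, n) \<in> edges t \<longleftrightarrow> q = p" for q using e parent_unique[OF t e] by blast
  have k: "key ?u m = (if m = n then (Str, x) else key t m)" for m
    using n by (simp add: key_def)
  have kn: "key t n = (Str, val t n)" using n by (simp add: key_def)
  have eq: "lbl ?u = lbl t" "edges ?u = edges t" by simp_all
  show "kids ?u A = kids t A" if "lbl t p \<noteq> El A"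
  proof -
    have "(m, l) \<in> kids ?u A \<longleftrightarrow> (m, l) \<in> kids t A" for m l
      unfolding mem_kids eq k using un that by (cases "m = n") auto
    then show ?thesis by auto
  qed
  assume p: "lbl t p = El A"
  define K where "K = {y \<in> kids t A. fst y \<noteq> n}"
  have K: "finite K" "(n, l) \<notin> K" for l
    using finite_kids[OF t, of A] by (auto simp: K_def)
  have "(m, l) \<in> kids t A \<longleftrightarrow> (m, l) \<in> insert (n, Str, val t n) K" for m l
    unfolding K_def using un p kn by (cases "m = n") (auto simp: mem_kids)
  then have 1: "kids t A = insert (n, Str, val t n) K" by auto
  have "(m, l) \<in> kids ?u A \<longleftrightarrow> (m, l) \<in> insert (n, Str, x) K" for m l
    unfolding K_def using un p k[of m] unfolding mem_kids eq by (cases "m = n") (auto simp: mem_kids)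
  then have 2: "kids ?u A = insert (n, Str, x) K" by auto
  show "\<exists>N. profile t A = add_mset (Str, val t n) N \<and> profile ?u A = add_mset (Str, x) N"
    unfolding profile_def 1 2 using K by auto
qed

text \<open>An \<open>A\<close>-node is either the root or a kid of a node whose type has
  \<open>A\<close> as a subelement type. Kids carry node identities, so agreement at those types
  fixes the set of \<open>A\<close>-nodes. This is the step that passes rigidity down the
  DTD.\<close>

lemma pop_eq_if_kids_eq:
  assumes t: "conforms D R t" and u: "conforms D R u" and r: "root u = root t"
    and k: "\<And>A' n x. (A', A) \<in> sub_rel D \<Longrightarrow>
      (n, El A, x) \<in> kids u A' \<longleftrightarrow> (n, El A, x) \<in> kids t A'"
  shows "pop u A = pop t A"
proof -
  \<comment> \<open>The situation is symmetric, so one inclusion is shown for arbitrary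
    \<open>x\<close> and \<open>y\<close> and used in both directions.\<close>
  have *: "n \<in> pop y A" if x: "conforms D R x" and y: "conforms D R y" and r: "root y = root x"
    and k: "\<And>A' n z. (A', A) \<in> sub_rel D \<Longrightarrow>
      (n, El A, z) \<in> kids x A' \<longleftrightarrow> (n, El A, z) \<in> kids y A'" and n: "n \<in> pop x A"
    for x y :: "('a, 'b) xtree" and n
  proof (cases "n = root x")
    case True
    then show ?thesis 
      using x y r n is_treeD(2)[OF conforms_is_tree[OF y]] by (auto simp: conforms_def pop_def)
  next
    case False
    have l: "n \<in> nodes x" "lbl x n = El A" using n by (auto simp: pop_def)
    then obtain p where p: "(p, n) \<in> edges x"
      using False is_treeD(6)[OF conforms_is_tree[OF x]] by blast
    from conforms_sub_rel[OF x p l(2)] obtain A' where A': "lbl x p = El A'" "(A', A) \<in> sub_rel D" .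
    then have "(n, key x n) \<in> kids x A'" using p by (auto simp: mem_kids)
    moreover have "key x n = (El A, [])" using l by (simp add: key_def)
    ultimately have "(n, key x n) \<in> kids y A'" using k[OF A'(2)] by simp
    then obtain q where "(q, n) \<in> edges y" "key x n = key y n" by (auto simp: mem_kids)
    then show ?thesis
      using l is_treeD(4)[OF conforms_is_tree[OF y]] by (auto simp: pop_def key_def)
  qed
  show ?thesis 
  proof (intro equalityI subsetI)
    show "n \<in> pop t A" if "n \<in> pop u A" for n using *[OF u t _ _ that] r k by simp
    show "n \<in> pop u A" if "n \<in> pop t A" for n using *[OF t u _ _ that] r k by simp
  qed
qed

text \<open>The trace that an update leaves on \<open>profile\<close> at its element type when the
  nodes of that type stay the same. The empty strings come from the masking in \<open>key\<close>;
  for \<open>URepS\<close> the two strings may coincide.\<close>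

fun effect :: "'l uat \<Rightarrow> ('l lab \<times> string) multiset \<Rightarrow> ('l lab \<times> string) multiset \<Rightarrow> bool" where
  "effect (UIns A B) M M' \<longleftrightarrow> M' = add_mset (El B, []) M"
| "effect (UDel A B) M M' \<longleftrightarrow> M = add_mset (El B, []) M'"
| "effect (URep A B B') M M' \<longleftrightarrow>
     (\<exists>N. M = add_mset (El B, []) N \<and> M' = add_mset (El B', []) N)"
| "effect (URepS A) M M' \<longleftrightarrow> (\<exists>N x y. M = add_mset (Str, x) N \<and> M' = add_mset (Str, y) N)"

text \<open>While the set of \<open>A\<close>-nodes stays fixed, inserted and deleted subtrees
  contain no \<open>A\<close>-node, so \<open>kids\<close> at \<open>A\<close> can change only
  directly below the edited node, whose type is the element type of \<open>v\<close>. The third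
  claim is needed node by node, to compare the nodes of one subelement type.\<close>

lemma apply_upd_effect:
  assumes c: "conforms D R t" and v: "v \<in> valid D" and m: "matches D t op v"
    and va: "valid_upd t op" and pop: "pop (apply_upd t op) A = pop t A"
  shows "uat_elem v \<noteq> A \<Longrightarrow> kids (apply_upd t op) A = kids t A"
    and "uat_elem v = A \<Longrightarrow> effect v (profile t A) (profile (apply_upd t op) A)"
    and "v = URep A X Y \<Longrightarrow> B \<noteq> X \<Longrightarrow> B \<noteq> Y \<Longrightarrow>
      (n, El B, x) \<in> kids (apply_upd t op) A \<longleftrightarrow> (n, El B, x) \<in> kids t A"
proof -
  have T: "is_tree t" using c by (rule conforms_is_tree)
  have "(uat_elem v \<noteq> A \<longrightarrow> kids (apply_upd t op) A = kids t A) \<and>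
    (uat_elem v = A \<longrightarrow> effect v (profile t A) (profile (apply_upd t op) A)) \<and>
    (v = URep A X Y \<longrightarrow> B \<noteq> X \<longrightarrow> B \<noteq> Y \<longrightarrow>
      (n, El B, x) \<in> kids (apply_upd t op) A \<longleftrightarrow> (n, El B, x) \<in> kids t A)"
    using m
  proof (cases rule: matches_cases)
    case (Ins n s A' B)
    then have n: "n \<in> nodes t" "nodes s \<inter> nodes t = {}" using va by auto
    have s: "is_tree s" "key s (root s) = (El B, [])"
      using Ins(4) by (auto simp: conforms_def key_def)
    have ps: "pop s A = {}"
      using pop n unfolding Ins(1) pop_Ins by (auto simp: pop_def)
    show ?thesis
      using kids_Ins[OF T s(1) n ps] profile_Ins[OF T s(1) n ps] s(2) Ins(1-3) by auto
  next
    case (Del n A' B)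
    note hp = has_parentD[OF T Del(4)]
    have pd: "pop t A \<inter> desc t n = {}"
      using pop unfolding Del(1) pop_Del by blast
    have "key t n = (El B, [])" using Del(3) by (simp add: key_def)
    then show ?thesis
      using kids_Del(1)[OF T hp(1) pd] profile_Del[OF T hp(1) pd] Del(1,2,5) by auto
  next
    case (Rep n s A' B B')
    let ?p = "parent t n" and ?t = "apply_upd t (Del n)"
    note hp = has_parentD[OF T Rep(4)]
    have K: "?p \<in> nodes ?t" using hp parent_notin_desc[OF T hp(1)] by simp
    have d: "nodes s \<inter> nodes ?t = {}" "nodes s \<inter> nodes t = {}" using va Rep(1) by auto
    have s: "is_tree s" "key s (root s) = (El B', [])"
      using Rep(6) by (auto simp: conforms_def key_def)
    have T': "is_tree ?t" by (rule is_tree_Del[OF T hp(2)])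
    have "pop t A = pop t A - desc t n - nodes s \<union> pop s A"
      using pop unfolding Rep(1) Rep_eq_Del_Ins pop_Ins pop_Del by simp
    \<comment> \<open>Inserted nodes are not in \<open>t\<close>, so they can neither join the fixed
      population nor make up for deleted \<open>A\<close>-nodes.\<close>
    moreover have "pop s A \<inter> nodes t = {}" "pop t A \<subseteq> nodes t"
      using d by (auto simp: pop_def)
    ultimately have ps: "pop s A = {}" and pd: "pop t A \<inter> desc t n = {}" by blast+
    have "key t n = (El B, [])" using Rep(3) by (simp add: key_def)
    then show ?thesis
      using kids_Del(1)[OF T hp(1) pd] profile_Del[OF T hp(1) pd]
        kids_Ins[OF T' s(1) K d(1) ps] profile_Ins[OF T' s(1) K d(1) ps] s(2) Rep(2,5)
      unfolding Rep(1) Rep_eq_Del_Ins by auto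
  next
    case (RepS n x A')
    note hp = has_parentD[OF T RepS(4)]
    show ?thesis
      using profile_RepS[OF T hp(1) RepS(3), of A x] RepS(1,2,5) by auto
  qed
  then show "uat_elem v \<noteq> A \<Longrightarrow> kids (apply_upd t op) A = kids t A"
    and "uat_elem v = A \<Longrightarrow> effect v (profile t A) (profile (apply_upd t op) A)"
    and "v = URep A X Y \<Longrightarrow> B \<noteq> X \<Longrightarrow> B \<noteq> Y \<Longrightarrow>
      (n, El B, x) \<in> kids (apply_upd t op) A \<longleftrightarrow> (n, El B, x) \<in> kids t A" by blast+
qed

lemma valid_sub_rel:
  "UIns A B \<in> valid D \<Longrightarrow> (A, B) \<in> sub_rel D"
  "UDel A B \<in> valid D \<Longrightarrow> (A, B) \<in> sub_rel D"
  "URep A B B' \<in> valid D \<Longrightarrow> (A, B) \<in> sub_rel D"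
  "URep A B B' \<in> valid D \<Longrightarrow> (A, B') \<in> sub_rel D"
  by (auto simp: valid_def sub_rel_def)

text \<open>Subtrees that are inserted or deleted are rooted at a subelement type of the element
  type, so they contain only types strictly below it.\<close>

lemma pop_apply_upd:
  assumes c: "conforms D R t" and v: "v \<in> valid D" and m: "matches D t op v"
    and va: "valid_upd t op" and A: "(uat_elem v, A) \<notin> (sub_rel D)\<^sup>+"
  shows "pop (apply_upd t op) A = pop t A"
proof -
  have T: "is_tree t" using c by (rule conforms_is_tree)
  have below: "(B, A) \<notin> le_D D" if "(uat_elem v, B) \<in> sub_rel D" for B
    using that A unfolding le_D_def by (meson rtrancl_into_trancl2)
  have ps: "pop s A = {}" if "(uat_elem v, B) \<in> sub_rel D" "conforms D B s"
    for B and s :: "('a, 'b) xtree"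
    using below[OF that(1)] conforms_root_le_D[OF that(2)] by (auto simp: pop_def)
  have pd: "pop t A \<inter> desc t n = {}" if "(uat_elem v, B) \<in> sub_rel D" "lbl t n = El B" for B n
    using below[OF that(1)] conforms_le_D[OF c _ that(2)] by (auto simp: pop_def desc_def)
  from m show ?thesis
  proof (cases rule: matches_cases)
    case (Ins n s A' B)
    have "pop s A = {}" using ps[of B s] Ins v valid_sub_rel(1)[of A' B D] by simp
    then show ?thesis using va unfolding Ins(1) pop_Ins by (auto simp: pop_def)
  next
    case (Del n A' B)
    then show ?thesis using pd[of B n] v valid_sub_rel(2)[of A' B D] unfolding Del(1) pop_Del by auto
  next
    case (Rep n s A' B B')
    have "pop s A = {}" "pop t A \<inter> desc t n = {}"
      using ps[of B' s] pd[of B n] Rep v valid_sub_rel(3,4)[of A' B B' D] by simp_all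
    then show ?thesis using va unfolding Rep(1) Rep_eq_Del_Ins pop_Ins pop_Del
      by (auto simp: pop_def)
  next
    case (RepS n x A')
    then show ?thesis by (simp add: pop_def)
  qed
qed

lemma root_apply_upd: "root (apply_upd t op) = root t"
  by (cases op) (simp_all add: Rep_eq_Del_Ins)

section \<open>Policies closed under the operator T are consistent\<close>

text \<open>Nodes of these types can be removed and rebuilt with arbitrary content by updates in \<open>S\<close>.\<close>

definition freed :: "'l dtd \<Rightarrow> 'l uat set \<Rightarrow> 'l set" where
  "freed D S = {C. (\<exists>A B. A \<in> Ele D \<and> Rg D A = RStar B \<and> UIns A B \<in> S \<and> UDel A B \<in> S
        \<and> (B, C) \<in> le_D D)
      \<or> (\<exists>A Bs B. A \<in> Ele D \<and> Rg D A = RDisj Bs \<and> B \<in> set Bs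
        \<and> (B, B) \<in> (G_A D A S)\<^sup>+ \<and> (B, C) \<in> le_D D)}"

section \<open>Idempotence of \<open>T_op\<close>\<close>

lemma T_op_eq:
  "T_op D S = S \<union> {u \<in> valid D. uat_elem u \<in> freed D S}
    \<union> {URep A X Y | A X Y. \<exists>Bs. A \<in> Ele D \<and> Rg D A = RDisj Bs \<and> X \<in> set Bs
        \<and> Y \<in> set Bs \<and> X \<noteq> Y \<and> (X, Y) \<in> (G_A D A S)\<^sup>+}"
  unfolding T_op_def freed_def by blast

lemma T_op_valid: "S \<subseteq> valid D \<Longrightarrow> T_op D S \<subseteq> valid D"
  unfolding T_op_eq by (auto simp: valid_def)

lemma freed_le_D:
  assumes "C \<in> freed D S" "(C, C') \<in> le_D D"
  shows "C' \<in> freed D S"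
proof -
  have "(B, C) \<in> le_D D \<Longrightarrow> (B, C') \<in> le_D D" for B
    using assms(2) unfolding le_D_def by (blast intro: rtrancl_trans)
  then show ?thesis using assms(1) unfolding freed_def by blast
qed

lemma freed_subelem:
  assumes "A \<in> freed D S" "A \<in> Ele D" "B \<in> subelems (Rg D A)"
  shows "B \<in> freed D S"
  using assms by (intro freed_le_D[OF assms(1)]) (auto simp: le_D_def sub_rel_def)

lemma T_op_not_freed:
  assumes "u \<in> T_op D S" "uat_elem u \<notin> freed D S"
  shows "u \<in> S \<or> (\<exists>A X Y. u = URep A X Y \<and> (X, Y) \<in> (G_A D A S)\<^sup>+)"
  using assms unfolding T_op_eq by blast

text \<open>Edges added at a type that is not freed are shortcuts of existing paths, so they create
  no new reachability.\<close>

lemma G_A_T_op: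
  assumes "A \<notin> freed D S"
  shows "(G_A D A (T_op D S))\<^sup>+ \<subseteq> (G_A D A S)\<^sup>+"
proof -
  have "G_A D A (T_op D S) \<subseteq> (G_A D A S)\<^sup>+"
    using T_op_not_freed[of _ D S] assms unfolding G_A_def by fastforce
  then have "(G_A D A (T_op D S))\<^sup>+ \<subseteq> ((G_A D A S)\<^sup>+)\<^sup>+" by (blast intro: trancl_mono)
  then show ?thesis by simp
qed

text \<open>A pair or cycle of \<open>T_op D S\<close> at \<open>A\<close> either sits at a freed
  \<open>A\<close>, whose subelement types are freed as well, or already gives such a pair or cycle
  of \<open>S\<close>.\<close>

lemma freed_T_op: "freed D (T_op D S) \<subseteq> freed D S"
proof
  fix C assume "C \<in> freed D (T_op D S)"
  then consider A B where "A \<in> Ele D" "Rg D A = RStar B" "UIns A B \<in> T_op D S"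
      "UDel A B \<in> T_op D S" "(B, C) \<in> le_D D"
    | A Bs B where "A \<in> Ele D" "Rg D A = RDisj Bs" "B \<in> set Bs"
      "(B, B) \<in> (G_A D A (T_op D S))\<^sup>+" "(B, C) \<in> le_D D"
    unfolding freed_def by blast
  then show "C \<in> freed D S"
  proof cases
    case 1
    show ?thesis
    proof (cases "A \<in> freed D S")
      case True
      then show ?thesis using 1 freed_subelem[of A D S B] freed_le_D[of B D S C] by simp
    next
      case False
      then have "UIns A B \<in> S" "UDel A B \<in> S"
        using T_op_not_freed[OF 1(3)] T_op_not_freed[OF 1(4)] by auto
      then show ?thesis using 1 unfolding freed_def by blast
    qed
  next
    case 2
    show ?thesis
    proof (cases "A \<in> freed D S")
      case True
      then show ?thesis using 2 freed_subelem[of A D S B] freed_le_D[of B D S C] by simp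
    next
      case False
      then have "(B, B) \<in> (G_A D A S)\<^sup>+" by (rule subsetD[OF G_A_T_op 2(4)])
      then show ?thesis using 2 unfolding freed_def by blast
    qed
  qed
qed

text \<open>The first application enlarges neither the freed types nor, away from them, reachability
  in the graphs, so the second finds nothing new. Hence condition (3), which applies
  \<open>T_op\<close> only once, yields a closed set.\<close>

lemma T_op_idem: "T_op D (T_op D S) \<subseteq> T_op D S"
proof
  fix u assume "u \<in> T_op D (T_op D S)"
  then consider "u \<in> T_op D S" | "u \<in> valid D" "uat_elem u \<in> freed D (T_op D S)"
    | A X Y Bs where "u = URep A X Y" "A \<in> Ele D" "Rg D A = RDisj Bs" "X \<in> set Bs"
      "Y \<in> set Bs" "X \<noteq> Y" "(X, Y) \<in> (G_A D A (T_op D S))\<^sup>+"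
    unfolding T_op_eq[of D "T_op D S"] by blast
  then show "u \<in> T_op D S"
  proof cases
    case 2
    with subsetD[OF freed_T_op 2(2)] show ?thesis unfolding T_op_eq[of D S] by simp
  next
    case 3
    show ?thesis
    proof (cases "A \<in> freed D S")
      case True
      moreover have "u \<in> valid D" using 3 by (simp add: valid_def)
      ultimately show ?thesis using 3(1) unfolding T_op_eq by simp
    next
      case False
      then have "(X, Y) \<in> (G_A D A S)\<^sup>+" by (rule subsetD[OF G_A_T_op 3(7)])
      then show ?thesis using 3(1-6) unfolding T_op_eq by blast
    qed
  qed
qed

section \<open>Monotone counts along a run\<close>

text \<open>The count is an integer so that its negative can serve as a nondecreasing potential when
  only deletions are allowed.\<close>

definition cnt :: "'l set \<Rightarrow> ('l lab \<times> string) multiset \<Rightarrow> int" where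
  "cnt U M = int (size {#k \<in># M. fst k \<in> El ` U#})"

lemma cnt_add_mset: "cnt U (add_mset (El B, x) M) = cnt U M + (if B \<in> U then 1 else 0)"
  by (auto simp: cnt_def)

lemma valid_RStar:
  assumes "v \<in> valid D" "uat_elem v = A" "Rg D A = RStar B"
  shows "v = UIns A B \<or> v = UDel A B"
  using assms by (cases v) (auto simp: valid_def)

lemma valid_RDisj:
  assumes "v \<in> valid D" "uat_elem v = A" "Rg D A = RDisj Bs"
  obtains X Y where "v = URep A X Y" "X \<in> set Bs" "Y \<in> set Bs" "X \<noteq> Y"
  using assms by (cases v) (auto simp: valid_def)

text \<open>The trees of an allowed sequence, indexed by position so that any two positions can be
  compared; beyond \<open>k\<close> the function \<open>s\<close> is unconstrained.\<close>

locale run =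
  fixes D :: "'l dtd" and S :: "'l uat set" and s :: "nat \<Rightarrow> ('l, 'n) xtree" and k :: nat
  assumes S_valid: "S \<subseteq> valid D"
    and conf: "i \<le> k \<Longrightarrow> conforms D (rt D) (s i)"
    and step: "i < k \<Longrightarrow> \<exists>op v. v \<in> S \<and> matches D (s i) op v \<and> valid_upd (s i) op \<and>
      s (Suc i) = apply_upd (s i) op"
begin

text \<open>Node sets are compared at every single step. Equal node sets at the two ends would not
  exclude that nodes vanish and return in between.\<close>

definition rigid :: "'l \<Rightarrow> bool" where
  "rigid A \<longleftrightarrow> (\<forall>i<k. pop (s (Suc i)) A = pop (s i) A)"

lemma step_effect:
  assumes "rigid A" "i < k"
  obtains "kids (s (Suc i)) A = kids (s i) A"
  | v where "v \<in> S" "uat_elem v = A" "effect v (profile (s i) A) (profile (s (Suc i)) A)"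
    "\<And>X Y B n x. v = URep A X Y \<Longrightarrow> B \<noteq> X \<Longrightarrow> B \<noteq> Y \<Longrightarrow>
      (n, El B, x) \<in> kids (s (Suc i)) A \<longleftrightarrow> (n, El B, x) \<in> kids (s i) A"
proof -
  obtain op v where o: "v \<in> S" "matches D (s i) op v" "valid_upd (s i) op"
    "s (Suc i) = apply_upd (s i) op" using step[OF assms(2)] by blast
  have p: "pop (apply_upd (s i) op) A = pop (s i) A"
    using assms o(4) unfolding rigid_def by metis
  have v: "v \<in> valid D" using o(1) S_valid by blast
  note e = apply_upd_effect[OF conf[OF less_imp_le[OF assms(2)]] v o(2,3) p]
  show ?thesis
  proof (cases "uat_elem v = A")
    case True
    then show ?thesis using that(2)[OF o(1)] e(2,3) unfolding o(4) by blast
  next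
    case False
    then show ?thesis using that(1) e(1) unfolding o(4) by blast
  qed
qed

text \<open>Steps with another element type leave \<open>kids\<close> at a rigid \<open>A\<close>
  unchanged, so a potential that no UAT of \<open>S\<close> at \<open>A\<close> lowers can only
  grow.\<close>

lemma potential_mono:
  fixes g :: "('l lab \<times> string) multiset \<Rightarrow> int"
  assumes r: "rigid A"
    and g: "\<And>v M M'. v \<in> S \<Longrightarrow> uat_elem v = A \<Longrightarrow> effect v M M' \<Longrightarrow> g M \<le> g M'"
  shows "i \<le> j \<Longrightarrow> j \<le> k \<Longrightarrow> g (profile (s i) A) \<le> g (profile (s j) A)"
proof (induction j rule: dec_induct)
  case (step j)
  then have "j < k" by simp
  with r have "g (profile (s j) A) \<le> g (profile (s (Suc j)) A)"
    by (cases rule: step_effect) (auto simp: profile_def intro: g[unfolded profile_def])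
  with step show ?case by simp
qed simp

text \<open>A monotone sequence with equal ends is constant in between.\<close>

lemma potential_const:
  fixes g :: "('l lab \<times> string) multiset \<Rightarrow> int"
  assumes r: "rigid A"
    and g: "\<And>v M M'. v \<in> S \<Longrightarrow> uat_elem v = A \<Longrightarrow> effect v M M' \<Longrightarrow> g M \<le> g M'"
    and c: "profile (s k) A = profile (s 0) A" and i: "i < k"
  shows "g (profile (s (Suc i)) A) = g (profile (s i) A)"
proof -
  have "g (profile (s 0) A) \<le> g (profile (s i) A)"
    "g (profile (s i) A) \<le> g (profile (s (Suc i)) A)"
    "g (profile (s (Suc i)) A) \<le> g (profile (s k) A)"
    using i by (auto intro: potential_mono[OF r g])
  then show ?thesis using c by simp
qed

text \<open>A replacement that starts in a set closed under the edges also ends in it.\<close>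

lemma cnt_closed_mono:
  assumes A: "Rg D A = RDisj Bs" and v: "v \<in> S" "uat_elem v = A" and e: "effect v M M'"
    and U: "\<And>X Y. (X, Y) \<in> G_A D A S \<Longrightarrow> X \<in> U \<Longrightarrow> Y \<in> U"
  shows "cnt U M \<le> cnt U M'"
proof -
  obtain X Y where XY: "v = URep A X Y" "X \<in> set Bs" "Y \<in> set Bs"
    using valid_RDisj[OF _ v(2) A] v(1) S_valid by blast
  then have "X \<in> U \<Longrightarrow> Y \<in> U" using U v A by (auto simp: G_A_def)
  then show ?thesis using e XY(1) by (auto simp: cnt_add_mset)
qed

text \<open>Below a star only insertions or only deletions are available, so the number of
  \<open>B\<close>-kids is monotone, hence constant, and no step at \<open>A\<close> can occur.
  Below a disjunction, constancy of the counts for all closed sets shows that each replacement made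
  in the run moves inside a cycle of \<open>G_A\<close>; as \<open>B\<close> lies on none, it is
  neither replaced nor introduced. Other productions admit no valid UAT with a subelement
  type.\<close>

lemma kids_const:
  assumes r: "rigid A" and AB: "(A, B) \<in> sub_rel D"
    and c: "profile (s k) A = profile (s 0) A" and i: "i < k"
    and star: "Rg D A = RStar B \<Longrightarrow> UIns A B \<notin> S \<or> UDel A B \<notin> S"
    and disj: "\<And>Bs. Rg D A = RDisj Bs \<Longrightarrow> (B, B) \<notin> (G_A D A S)\<^sup>+"
  shows "(n, El B, x) \<in> kids (s (Suc i)) A \<longleftrightarrow> (n, El B, x) \<in> kids (s i) A"
  using r i
proof (cases rule: step_effect)
  case 1
  then show ?thesis by simp
next
  case (2 v)
  have vD: "v \<in> valid D" using 2(1) S_valid by blast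
  show ?thesis
  proof (cases "Rg D A")
    case (RStar B')
    with AB have B: "Rg D A = RStar B" by (simp add: sub_rel_def)
    note vs = valid_RStar[OF _ _ B]
    from vs[OF vD 2(2)] consider "v = UIns A B" | "v = UDel A B" by blast
    then show ?thesis
    proof cases
      case 1
      with star[OF B] 2(1) have "UDel A B \<notin> S" by blast
      then have only: "w \<in> S \<Longrightarrow> uat_elem w = A \<Longrightarrow> w = UIns A B" for w
        using vs[of w] S_valid by (metis subsetD)
      have "cnt {B} M \<le> cnt {B} M'" if "w \<in> S" "uat_elem w = A" "effect w M M'" for w M M'
        using only[OF that(1,2)] that(3) by (simp add: cnt_add_mset)
      then have "cnt {B} (profile (s (Suc i)) A) = cnt {B} (profile (s i) A)"
        by (intro potential_const[OF r _ c i])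
      \<comment> \<open>An insertion would raise the count just shown to be constant, so this case
        is contradictory.\<close>
      then show ?thesis using 2(3) 1 by (simp add: cnt_add_mset)
    next
      case uat: 2
      with star[OF B] 2(1) have "UIns A B \<notin> S" by blast
      then have only: "w \<in> S \<Longrightarrow> uat_elem w = A \<Longrightarrow> w = UDel A B" for w
        using vs[of w] S_valid by (metis subsetD)
      have "- cnt {B} M \<le> - cnt {B} M'" if "w \<in> S" "uat_elem w = A" "effect w M M'" for w M M'
        using only[OF that(1,2)] that(3) by (simp add: cnt_add_mset)
      then have "- cnt {B} (profile (s (Suc i)) A) = - cnt {B} (profile (s i) A)"
        by (intro potential_const[OF r _ c i])
      then show ?thesis using 2(3) uat by (simp add: cnt_add_mset)
    qed
  next
    case (RDisj Bs)
    obtain X Y where XY: "v = URep A X Y" "X \<in> set Bs" "Y \<in> set Bs" "X \<noteq> Y"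
      using valid_RDisj[OF vD 2(2) RDisj] by blast
    let ?G = "G_A D A S"
    have G: "(X, Y) \<in> ?G" using XY 2(1) RDisj by (auto simp: G_A_def)
    \<comment> \<open>A step from \<open>X\<close> to \<open>Y\<close> keeps the count for
      \<open>U\<close> only if both lie in \<open>U\<close> or neither does.\<close>
    have const: "X \<in> U \<longleftrightarrow> Y \<in> U" if "\<And>X Y. (X, Y) \<in> ?G \<Longrightarrow> X \<in> U \<Longrightarrow> Y \<in> U" for U
    proof -
      have "cnt U (profile (s (Suc i)) A) = cnt U (profile (s i) A)"
        by (rule potential_const[OF r _ c i]) (rule cnt_closed_mono[OF RDisj _ _ _ that])
      then show ?thesis using 2(3) XY(1) by (auto simp: cnt_add_mset split: if_splits)
    qed
    have "B \<noteq> Y"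
    proof
      \<comment> \<open>The closed set is everything reachable from \<open>B\<close>. It contains
        \<open>Y\<close> by reflexivity, hence \<open>X\<close>, and the edge from \<open>X\<close>
        back to \<open>B\<close> closes a cycle.\<close>
      assume "B = Y"
      have "X \<in> {Z. (B, Z) \<in> ?G\<^sup>*} \<longleftrightarrow> Y \<in> {Z. (B, Z) \<in> ?G\<^sup>*}"
        by (rule const) (auto intro: rtrancl_into_rtrancl)
      then have "(B, X) \<in> ?G\<^sup>*" using \<open>B = Y\<close> by simp
      then show False using G \<open>B = Y\<close> disj[OF RDisj] by (blast intro: rtrancl_into_trancl1)
    qed
    moreover have "B \<noteq> X"
    proof
      \<comment> \<open>Here reachability by at least one edge is taken: the set contains
        \<open>Y\<close>, hence \<open>X\<close>, which puts \<open>B\<close> on a cycle.\<close>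
      assume "B = X"
      have "X \<in> {Z. (B, Z) \<in> ?G\<^sup>+} \<longleftrightarrow> Y \<in> {Z. (B, Z) \<in> ?G\<^sup>+}"
        by (rule const) (auto intro: trancl_into_trancl)
      then show False using G \<open>B = X\<close> disj[OF RDisj] by auto
    qed
    ultimately show ?thesis using 2(4)[OF XY(1)] by blast
  qed (use AB vD 2(2) in \<open>cases v; auto simp: sub_rel_def valid_def\<close>)+
qed

end

lemma finite_sub_rel: "is_dtd D \<Longrightarrow> finite (sub_rel D)"
  by (rule finite_subset[of _ "Ele D \<times> Ele D"]) (auto simp: is_dtd_def sub_rel_def)

lemma le_D_not_trancl:
  assumes "is_dtd D" "(A, C) \<in> le_D D"
  shows "(C, A) \<notin> (sub_rel D)\<^sup>+"
proof
  assume "(C, A) \<in> (sub_rel D)\<^sup>+"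
  with assms(2) have "(C, C) \<in> (sub_rel D)\<^sup>+"
    unfolding le_D_def by (rule trancl_rtrancl_trancl[rotated])
  then show False using assms(1) by (simp add: is_dtd_def acyclic_def)
qed

text \<open>Well-founded induction over \<open>sub_rel\<close> runs from parent types to subelement
  types. The parent types of \<open>A\<close> lie strictly above \<open>C\<close>, so they are rigid
  by induction and have equal profiles at both ends; \<open>kids_const\<close> then freezes their
  \<open>A\<close>-kids and with them the set of \<open>A\<close>-nodes.\<close>

lemma (in run) all_above_rigid:
  assumes D: "is_dtd D" and CC: "(A, C) \<in> le_D D"
    and prof: "\<And>A. (A, C) \<in> (sub_rel D)\<^sup>+ \<Longrightarrow> profile (s k) A = profile (s 0) A"
    and star: "\<And>A B. A \<in> Ele D \<Longrightarrow> Rg D A = RStar B \<Longrightarrow> (B, C) \<in> le_D D \<Longrightarrow>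
      UIns A B \<notin> S \<or> UDel A B \<notin> S"
    and disj: "\<And>A B Bs. A \<in> Ele D \<Longrightarrow> Rg D A = RDisj Bs \<Longrightarrow> B \<in> set Bs \<Longrightarrow>
      (B, C) \<in> le_D D \<Longrightarrow> (B, B) \<notin> (G_A D A S)\<^sup>+"
  shows "rigid A"
proof -
  have "wf (sub_rel D)"
    using finite_acyclic_wf[OF finite_sub_rel[OF D]] D by (simp add: is_dtd_def)
  then show ?thesis using CC
  proof (induction A rule: wf_induct_rule)
    case (less A)
    show ?case unfolding rigid_def
    proof (intro allI impI)
      fix i assume i: "i < k"
      have same: "(n, El A, x) \<in> kids (s (Suc i)) A' \<longleftrightarrow> (n, El A, x) \<in> kids (s i) A'"
        if A': "(A', A) \<in> sub_rel D" for A' n x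
      proof (rule kids_const[OF _ A' _ i])
        have C: "(A', C) \<in> (sub_rel D)\<^sup>+"
          using A' less.prems unfolding le_D_def by (rule rtrancl_into_trancl2)
        then show "profile (s k) A' = profile (s 0) A'" by (rule prof)
        show "rigid A'" using less.IH[OF A'] C unfolding le_D_def by (simp add: trancl_into_rtrancl)
        have E: "A' \<in> Ele D" "A \<in> subelems (Rg D A')" using A' by (auto simp: sub_rel_def)
        then show "Rg D A' = RStar A \<Longrightarrow> UIns A' A \<notin> S \<or> UDel A' A \<notin> S"
          using star less.prems by blast
        show "(A, A) \<notin> (G_A D A' S)\<^sup>+" if "Rg D A' = RDisj Bs" for Bs
          using disj[OF E(1) that] E(2) that less.prems by simp
      qed
      obtain op where "s (Suc i) = apply_upd (s i) op" using step[OF i] by blast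
      then have "root (s (Suc i)) = root (s i)" by (simp add: root_apply_upd del: apply_upd.simps)
      with same i show "pop (s (Suc i)) A = pop (s i) A"
        by (intro pop_eq_if_kids_eq[OF conf conf]) auto
    qed
  qed
qed

section \<open>Allowed sequences as runs\<close>

lemma apply_seq_Suc:
  "i < length ops \<Longrightarrow>
   apply_seq t (take (Suc i) ops) = apply_upd (apply_seq t (take i ops)) (ops ! i)"
  by (simp add: apply_seq_def take_Suc_conv_app_nth)

lemma allowed_nth:
  assumes "allowed D S t ops" "i < length ops"
  shows "valid_upd (apply_seq t (take i ops)) (ops ! i)"
    and "ops ! i \<in> sem D S (apply_seq t (take i ops))"
  using assms
proof (induction ops arbitrary: t i)
  case (Cons op ops)
  {
    case 1 then show ?case using Cons.IH(1) by (cases i) (auto simp: apply_seq_def)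
  next
    case 2 then show ?case using Cons.IH(2) by (cases i) (auto simp: apply_seq_def)
  }
qed simp_all

lemma run_of_allowed:
  assumes S: "S \<subseteq> valid D" and t: "conforms D (rt D) t" and a: "allowed D S t ops"
  shows "run D S (\<lambda>i. apply_seq t (take i ops)) (length ops)"
proof -
  have st: "\<exists>op v. v \<in> S \<and> matches D (apply_seq t (take i ops)) op v \<and>
      valid_upd (apply_seq t (take i ops)) op \<and>
      apply_seq t (take (Suc i) ops) = apply_upd (apply_seq t (take i ops)) op"
    if "i < length ops" for i
    using allowed_nth[OF a that] apply_seq_Suc[OF that] unfolding sem_def by blast
  have "conforms D (rt D) (apply_seq t (take i ops))" if "i \<le> length ops" for i
    using that
  proof (induction i)
    case 0
    then show ?case using t by (simp add: apply_seq_def)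
  next
    case (Suc i)
    then obtain op v where "v \<in> S" "matches D (apply_seq t (take i ops)) op v"
      "valid_upd (apply_seq t (take i ops)) op"
      "apply_seq t (take (Suc i) ops) = apply_upd (apply_seq t (take i ops)) op"
      using st[of i] by auto
    with Suc S conforms_apply_upd[of D "rt D" "apply_seq t (take i ops)" v op]
    show ?case by auto
  qed
  then show ?thesis using S st by unfold_locales auto
qed

lemma iso_refl: "iso t t"
  unfolding iso_def by (rule exI[of _ id]) auto

text \<open>Everything outside \<open>S\<close> is forbidden, so the result applies directly to a
  total extension.\<close>

lemma T_closed_consistent:
  fixes D :: "'l dtd"
  assumes D: "is_dtd D" and S: "S \<subseteq> valid D" and T: "T_op D S \<subseteq> S"
  shows "consistent D (S, valid D - S) TYPE('n)"
proof -
  have False if t: "conforms D (rt D) t" and a: "allowed D S t ops"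
    and u: "u \<in> valid D" "u \<notin> S" and m: "matches D t op0 u" and va: "valid_upd t op0"
    and nt: "\<not> iso (apply_upd t op0) t" and i: "iso (apply_seq t ops) (apply_upd t op0)"
    for t :: "('l, 'n) xtree" and ops op0 u
  proof -
    define C where "C = uat_elem u"
    interpret run D S "\<lambda>i. apply_seq t (take i ops)" "length ops"
      by (rule run_of_allowed[OF S t a])
    let ?s = "\<lambda>i. apply_seq t (take i ops)" and ?k = "length ops"
    have s0: "?s 0 = t" by (simp add: apply_seq_def)
    have t': "conforms D (rt D) (apply_upd t op0)"
      by (rule conforms_apply_upd[OF t u(1) m va])
    \<comment> \<open>The only use of the simulation: isomorphic ends have equal profiles at every
      type.\<close>
    have final: "profile (?s ?k) A = profile (apply_upd t op0) A" for A
      using profile_cong_iso[OF conforms_is_tree[OF conf] conforms_is_tree[OF t'], of ?k A] i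
      by simp
    \<comment> \<open>By acyclicity a type at or above \<open>C\<close> is not strictly below
      \<open>C\<close>, so \<open>op0\<close> neither adds nor removes nodes of that type.\<close>
    have popC: "pop (apply_upd t op0) A = pop t A" if "(A, C) \<in> le_D D" for A
      using pop_apply_upd[OF t u(1) m va] le_D_not_trancl[OF D that] unfolding C_def by blast
    note eff = apply_upd_effect[OF t u(1) m va popC]
    have C: "rigid C"
    proof (rule all_above_rigid[OF D])
      show "(C, C) \<in> le_D D" by (simp add: le_D_def)
      show "profile (?s ?k) A = profile (?s 0) A" if A: "(A, C) \<in> (sub_rel D)\<^sup>+" for A
      proof -
        have "A \<noteq> C" using A D by (auto simp: is_dtd_def acyclic_def)
        moreover have "(A, C) \<in> le_D D" using A by (simp add: le_D_def trancl_into_rtrancl)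
        ultimately have "kids (apply_upd t op0) A = kids t A" using eff(1) C_def by blast
        then show ?thesis unfolding final s0 by (simp add: profile_def)
      qed
      show "UIns A B \<notin> S \<or> UDel A B \<notin> S"
        if "A \<in> Ele D" "Rg D A = RStar B" "(B, C) \<in> le_D D" for A B
      proof -
        \<comment> \<open>If \<open>C\<close> were freed, \<open>T_op\<close> would add
          \<open>u\<close>, and closedness would put it into \<open>S\<close>.\<close>
        have "C \<notin> freed D S" using T u unfolding T_op_eq C_def by blast
        then show ?thesis using that unfolding freed_def by blast
      qed
      show "(B, B) \<notin> (G_A D A S)\<^sup>+"
        if "A \<in> Ele D" "Rg D A = RDisj Bs" "B \<in> set Bs" "(B, C) \<in> le_D D" for A B Bs
      proof -
        have "C \<notin> freed D S" using T u unfolding T_op_eq C_def by blast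
        then show ?thesis using that unfolding freed_def by blast
      qed
    qed
    have CC: "(C, C) \<in> le_D D" by (simp add: le_D_def)
    \<comment> \<open>Rigidity of \<open>C\<close> bounds potentials from below along the allowed
      run, and the profile at its end is that of the forbidden result.\<close>
    have mono: "g (profile t C) \<le> g (profile (apply_upd t op0) C)"
      if "\<And>v M M'. v \<in> S \<Longrightarrow> uat_elem v = C \<Longrightarrow> effect v M M' \<Longrightarrow> g M \<le> g M'"
      for g :: "('l lab \<times> string) multiset \<Rightarrow> int"
      using potential_mono[where g = g and i = 0 and j = ?k, OF C that] s0 final by simp
    have e: "effect u (profile t C) (profile (apply_upd t op0) C)"
      using eff(2)[OF CC] C_def by simp
    show False
    proof (cases u)
      case (UIns A B)
      then have A: "A = C" "Rg D C = RStar B" using u by (auto simp: C_def valid_def)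
      \<comment> \<open>The insertion is \<open>u\<close> itself, which is not in \<open>S\<close>,
        so only the deletion remains at \<open>C\<close>.\<close>
      have only: "w = UDel C B" if "w \<in> S" "uat_elem w = C" for w
        using valid_RStar[OF _ that(2) A(2)] that S u UIns A by blast
      have "- cnt {B} M \<le> - cnt {B} M'" if "w \<in> S" "uat_elem w = C" "effect w M M'" for w M M'
        using only[OF that(1,2)] that(3) by (simp add: cnt_add_mset)
      then have "- cnt {B} (profile t C) \<le> - cnt {B} (profile (apply_upd t op0) C)"
        by (intro mono)
      then show False using e UIns by (simp add: cnt_add_mset)
    next
      case (UDel A B)
      then have A: "A = C" "Rg D C = RStar B" using u by (auto simp: C_def valid_def)
      have only: "w = UIns C B" if "w \<in> S" "uat_elem w = C" for w
        using valid_RStar[OF _ that(2) A(2)] that S u UDel A by blast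
      have "cnt {B} M \<le> cnt {B} M'" if "w \<in> S" "uat_elem w = C" "effect w M M'" for w M M'
        using only[OF that(1,2)] that(3) by (simp add: cnt_add_mset)
      then have "cnt {B} (profile t C) \<le> cnt {B} (profile (apply_upd t op0) C)"
        by (intro mono)
      then show False using e UDel by (simp add: cnt_add_mset)
    next
      case (URep A X Y)
      then obtain Bs where A: "A = C" "C \<in> Ele D" "Rg D C = RDisj Bs" "X \<in> set Bs" "Y \<in> set Bs" "X \<noteq> Y"
        using u by (auto simp: C_def valid_def)
      \<comment> \<open>The set reachable from \<open>X\<close> contains \<open>X\<close> but not
        \<open>Y\<close>, as otherwise \<open>T_op\<close> would contain \<open>u\<close>. Allowed
        replacements never lower its count, whereas the forbidden one does.\<close>
      let ?U = "{Z. (X, Z) \<in> (G_A D C S)\<^sup>*}"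
      have "cnt ?U (profile t C) \<le> cnt ?U (profile (apply_upd t op0) C)"
        by (rule mono, rule cnt_closed_mono[OF A(3)]) (auto intro: rtrancl_into_rtrancl)
      moreover have "(X, Y) \<notin> (G_A D C S)\<^sup>+"
      proof
        assume "(X, Y) \<in> (G_A D C S)\<^sup>+"
        then have "URep C X Y \<in> T_op D S" using A unfolding T_op_def by blast
        then show False using T u URep A by blast
      qed
      then have "Y \<notin> ?U" using A(6) by (auto simp: rtrancl_eq_or_trancl)
      ultimately show False using e URep by (auto simp: cnt_add_mset)
    next
      case (URepS A)
      then have A: "A = C" "Rg D C = RStr" using u by (auto simp: C_def valid_def)
      have no: "uat_elem w \<noteq> C" if "w \<in> S" for w
        using that S u URepS A by (cases w) (auto simp: valid_def)
      obtain n x where op0: "op0 = RepS n x" "lbl t n = Str" "has_parent t n"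
        "lbl t (parent t n) = El C"
        using m URepS A by (cases rule: matches_cases) auto
      \<comment> \<open>Non-triviality of \<open>op0\<close> enters here: writing the old string
        again would return \<open>t\<close>.\<close>
      have "val t n \<noteq> x"
      proof
        assume "val t n = x"
        then have "apply_upd t op0 = t" using op0(1) by auto
        then show False using nt iso_refl by metis
      qed
      moreover obtain N where "profile t C = add_mset (Str, val t n) N"
        "profile (apply_upd t op0) C = add_mset (Str, x) N"
        using profile_RepS(2)[OF conforms_is_tree[OF t]
            has_parentD(1)[OF conforms_is_tree[OF t] op0(3)] op0(2,4)]
          op0(1) by blast
      \<comment> \<open>With no allowed UAT at \<open>C\<close> every function is a potential; the
        chosen one counts the old string, which \<open>op0\<close> makes rarer.\<close>
      moreover have "int (count (profile t C) (Str, val t n)) \<le>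
          int (count (profile (apply_upd t op0) C) (Str, val t n))"
        by (rule mono) (use no in blast)
      ultimately show False by simp
    qed
  qed
  then show ?thesis unfolding consistent_def by (auto simp: I_D_def sem_def)
qed

section \<open>Witness trees\<close>

text \<open>Equality up to the junk values of \<^const>\<open>lbl\<close> and \<^const>\<open>val\<close> outside the node set.\<close>

definition agree :: "('l, 'n) xtree \<Rightarrow> ('l, 'n) xtree \<Rightarrow> bool" where
  "agree t u \<longleftrightarrow> nodes t = nodes u \<and> edges t = edges u \<and> root t = root u
     \<and> (\<forall>n \<in> nodes t. lbl t n = lbl u n \<and> val t n = val u n)"

lemma agree_refl: "agree t t"
  and agree_sym: "agree t u \<Longrightarrow> agree u t"
  and agree_trans [trans]: "agree t u \<Longrightarrow> agree u w \<Longrightarrow> agree t w"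
  by (auto simp: agree_def)

lemma agree_iso: "agree t u \<Longrightarrow> iso t u"
  unfolding iso_def agree_def by (intro exI[of _ id]) auto

lemma agree_parent: "agree t u \<Longrightarrow> parent t n = parent u n"
  and agree_has_parent: "agree t u \<Longrightarrow> has_parent t n = has_parent u n"
  and agree_desc: "agree t u \<Longrightarrow> desc t n = desc u n"
  by (auto simp: agree_def parent_def has_parent_def desc_def)

lemma agree_Ins: "agree t u \<Longrightarrow> agree (apply_upd t (Ins p s)) (apply_upd u (Ins p s))"
  by (auto simp: agree_def)

lemma agree_Del: "agree t u \<Longrightarrow> agree (apply_upd t (Del n)) (apply_upd u (Del n))"
  using agree_desc[of t u n] by (auto simp: agree_def)

lemma agree_Rep: "agree t u \<Longrightarrow> agree (apply_upd t (Rep n s)) (apply_upd u (Rep n s))"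
  unfolding Rep_eq_Del_Ins agree_parent[of t u] by (intro agree_Ins agree_Del)

section \<open>Updates inside a grafted subtree\<close>

lemma Ins_Ins:
  "apply_upd (apply_upd t (Ins p s)) (Ins q r) = apply_upd t (Ins p (apply_upd s (Ins q r)))"
  if "q \<in> nodes s"
  by (auto simp: fun_eq_iff)

lemma desc_Ins:
  assumes "is_tree t" "is_tree s" "p \<in> nodes t" "nodes s \<inter> nodes t = {}" "n \<in> nodes s"
  shows "desc (apply_upd t (Ins p s)) n = desc s n"
proof -
  let ?E = "edges t \<union> edges s \<union> {(p, root s)}"
  have "(n, m) \<in> (edges s)\<^sup>* \<and> m \<in> nodes s" if "(n, m) \<in> ?E\<^sup>*" for m
    using that
  proof (induction rule: rtrancl_induct)
    case (step y z)
    then have "(y, z) \<in> edges s"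
      using assms(3,4) is_treeD(3)[OF assms(1), of y z] by blast
    then show ?case
      using step.IH is_treeD(4)[OF assms(2), of y z] by (auto intro: rtrancl_into_rtrancl)
  qed (simp add: assms(5))
  moreover have "(edges s)\<^sup>* \<subseteq> ?E\<^sup>*" by (rule rtrancl_mono) blast
  ultimately show ?thesis by (auto simp: desc_def)
qed

lemma desc_root: "is_tree t \<Longrightarrow> desc t (root t) = nodes t"
  using desc_subset_nodes[of t "root t"] is_treeD(2)[of t] is_treeD(7)[of t]
  by (auto simp: desc_def)

text \<open>Only \<open>agree\<close> can be expected: at the deleted nodes the junk labels come
  from \<open>s\<close> on one side and from \<open>t\<close> on the other.\<close>

lemma Del_in_graft:
  assumes t: "is_tree t" and s: "is_tree s" and p: "p \<in> nodes t"
    and disj: "nodes s \<inter> nodes t = {}" and n: "n \<in> nodes s" "n \<noteq> root s"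
  shows "agree (apply_upd (apply_upd t (Ins p s)) (Del n))
    (apply_upd t (Ins p (apply_upd s (Del n))))"
proof -
  have d: "desc (apply_upd t (Ins p s)) n = desc s n"
    by (rule desc_Ins[OF t s p disj n(1)])
  have "desc s n \<inter> nodes t = {}" using desc_subset_nodes[OF s n(1)] disj by blast
  moreover have "root s \<in> nodes s - desc s n"
    using root_notin_desc[OF s n(2)] is_treeD(2)[OF s] by blast
  ultimately show ?thesis
    using is_treeD(3,4)[OF t] is_treeD(3,4)[OF s] p disj
    unfolding agree_def Del_sels d by auto
qed

lemma Del_graft:
  assumes t: "is_tree t" and s: "is_tree s" and p: "p \<in> nodes t"
    and disj: "nodes s \<inter> nodes t = {}"
  shows "agree (apply_upd (apply_upd t (Ins p s)) (Del (root s))) t"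
proof -
  have d: "desc (apply_upd t (Ins p s)) (root s) = nodes s"
    using desc_Ins[OF t s p disj is_treeD(2)[OF s]] desc_root[OF s] by simp
  have "(a, b) \<in> edges t \<Longrightarrow> a \<in> nodes t - nodes s \<and> b \<in> nodes t - nodes s"
    "(a, b) \<in> edges s \<Longrightarrow> a \<in> nodes s" for a b
    using is_treeD(3,4)[OF t, of a b] is_treeD(3)[OF s, of a b] disj by blast+
  then show ?thesis
    using is_treeD(2)[OF s] disj unfolding agree_def Del_sels d by auto
qed

lemma parent_graft:
  assumes "is_tree t" "is_tree s" "p \<in> nodes t" "nodes s \<inter> nodes t = {}"
  shows "parent (apply_upd t (Ins p s)) (root s) = p"
    and "has_parent (apply_upd t (Ins p s)) (root s)"
  using parent_eq[OF is_tree_Ins[OF assms], of p "root s"] by (auto simp: has_parent_def)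

lemma parent_in_graft:
  assumes "is_tree t" "is_tree s" "p \<in> nodes t" "nodes s \<inter> nodes t = {}" "has_parent s n"
  shows "parent (apply_upd t (Ins p s)) n = parent s n"
    and "has_parent (apply_upd t (Ins p s)) n"
  using parent_eq[OF is_tree_Ins[OF assms(1-4)], of "parent s n" n] has_parentD(1)[OF assms(2,5)]
  by (auto simp: has_parent_def)

text \<open>Assuming only that \<open>u\<close> agrees with the graft allows replacements to be
  chained although each of them changes junk values.\<close>

lemma Rep_graft:
  assumes a: "agree u (apply_upd t (Ins p s))"
    and ts: "is_tree t" "is_tree s" "p \<in> nodes t" "nodes s \<inter> nodes t = {}"
  shows "agree (apply_upd u (Rep (root s) s')) (apply_upd t (Ins p s'))"
proof -
  have "agree (apply_upd u (Rep (root s) s')) (apply_upd (apply_upd t (Ins p s)) (Rep (root s) s'))"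
    by (rule agree_Rep[OF a])
  also have "agree \<dots> (apply_upd t (Ins p s'))"
    unfolding Rep_eq_Del_Ins parent_graft[OF ts] by (rule agree_Ins[OF Del_graft[OF ts]])
  finally show ?thesis .
qed

text \<open>Moves an update from a small tree into a large one that contains it. For
  \<open>Del\<close> and \<open>Rep\<close> the edited node has its parent within \<open>s\<close>,
  so it is not the root of \<open>s\<close> and the point of attachment stays.\<close>

lemma upd_in_graft:
  assumes ts: "is_tree t" "is_tree s" "p \<in> nodes t" "nodes s \<inter> nodes t = {}"
    and disj: "nodes (apply_upd s op) \<inter> nodes t = {}"
    and m: "matches D s op v" and va: "valid_upd s op"
  shows "matches D (apply_upd t (Ins p s)) op v"
    and "valid_upd (apply_upd t (Ins p s)) op"
    and "agree (apply_upd (apply_upd t (Ins p s)) op) (apply_upd t (Ins p (apply_upd s op)))"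
proof -
  let ?u = "apply_upd t (Ins p s)"
  have l: "lbl ?u n = lbl s n" "n \<in> nodes ?u" if "n \<in> nodes s" for n using that by auto
  have "matches D ?u op v \<and> valid_upd ?u op \<and>
    agree (apply_upd ?u op) (apply_upd t (Ins p (apply_upd s op)))"
    using m
  proof (cases rule: matches_cases)
    case (Ins n r A B)
    then have n: "n \<in> nodes s" using va by simp
    have "nodes r \<inter> nodes ?u = {}" using va disj Ins by auto
    moreover have "agree (apply_upd ?u op) (apply_upd t (Ins p (apply_upd s op)))"
      unfolding Ins(1) Ins_Ins[OF n] by (rule agree_refl)
    moreover have "matches D ?u op v" using l[OF n] Ins by (simp add: I_D_def)
    ultimately show ?thesis using l[OF n] Ins(1) by (simp del: apply_upd.simps)
  next
    case (Del n A B)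
    note hp = has_parentD[OF ts(2) Del(4)] and pg = parent_in_graft[OF ts Del(4)]
    show ?thesis
      using Del_in_graft[OF ts hp(3,2)] l[OF hp(3)] l[OF hp(4)] Del pg
      by (simp del: apply_upd.simps)
  next
    case (Rep n r A B B')
    note hp = has_parentD[OF ts(2) Rep(4)] and pg = parent_in_graft[OF ts Rep(4)]
    have q: "parent s n \<in> nodes (apply_upd s (Del n))"
      using hp parent_notin_desc[OF ts(2) hp(1)] by simp
    have "nodes r \<inter> nodes ?u = {}" using va disj Rep by (auto simp: Rep_eq_Del_Ins)
    moreover have "agree (apply_upd ?u op) (apply_upd t (Ins p (apply_upd s op)))"
      unfolding Rep(1) Rep_eq_Del_Ins pg(1) Ins_Ins[OF q, symmetric]
      by (intro agree_Ins Del_in_graft[OF ts hp(3,2)])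
    moreover have "matches D ?u op v"
      using l[OF hp(3)] l[OF hp(4)] Rep pg by (simp add: I_D_def del: apply_upd.simps)
    ultimately show ?thesis using l[OF hp(3)] Rep(1) by (simp del: apply_upd.simps)
  next
    case (RepS n x A)
    note hp = has_parentD[OF ts(2) RepS(4)] and pg = parent_in_graft[OF ts RepS(4)]
    have "agree (apply_upd ?u op) (apply_upd t (Ins p (apply_upd s op)))"
      using hp(3) RepS(1) by (auto simp: agree_def)
    moreover have "matches D ?u op v"
      using l[OF hp(3)] l[OF hp(4)] RepS pg by (simp del: apply_upd.simps)
    ultimately show ?thesis using l[OF hp(3)] RepS(1) by (simp del: apply_upd.simps)
  qed
  then show "matches D ?u op v" "valid_upd ?u op"
    "agree (apply_upd ?u op) (apply_upd t (Ins p (apply_upd s op)))" by blast+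
qed

section \<open>Construction of conforming trees and contexts\<close>

definition leaf :: "'n \<Rightarrow> 'l lab \<Rightarrow> ('l, 'n) xtree" where
  "leaf n X = \<lparr>nodes = {n}, edges = {}, lbl = (\<lambda>_. X), root = n, val = (\<lambda>_. [])\<rparr>"

lemma leaf_sels [simp]:
  "nodes (leaf n X) = {n}" "root (leaf n X) = n" "lbl (leaf n X) m = X" "val (leaf n X) m = []"
  "children (leaf n X) m = {}" "child_labels (leaf n X) m = {#}"
  by (simp_all add: leaf_def children_def child_labels_def)

lemma is_tree_leaf: "is_tree (leaf n X)"
  by (simp add: is_tree_def leaf_def)

lemma pconf_leaf: "X \<in> El ` Ele D \<union> {Str} \<Longrightarrow> pconf D X {n} (leaf n X)"
  by (simp add: pconf_def is_tree_leaf)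

lemma pconf_leaf_Str: "pconf D Str {} (leaf n Str)"
  by (simp add: pconf_def is_tree_leaf)

text \<open>Children are inserted one at a time while \<open>p\<close> stays a hole. The first
  assumption supplies each subtree away from any finite set, in particular from the part built so
  far.\<close>

lemma pconf_add_children:
  fixes t :: "('l, 'n) xtree"
  assumes "\<And>X F. X \<in> set Xs \<Longrightarrow> finite F \<Longrightarrow> \<exists>s :: ('l, 'n) xtree. pconf D X {} s \<and> nodes s \<inter> F = {}"
    and "pconf D R H t" "p \<in> H" "p \<in> nodes t" "lbl t p \<noteq> Str" "finite F" "nodes t \<inter> F = {}"
  shows "\<exists>u. pconf D R H u \<and> nodes t \<subseteq> nodes u \<and> nodes u \<inter> F = {}
    \<and> (\<forall>q \<in> nodes t. lbl u q = lbl t q) \<and> child_labels u p = mset Xs + child_labels t p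
    \<and> (\<forall>q \<in> nodes t - {p}. child_labels u q = child_labels t q)"
  using assms
proof (induction Xs)
  case Nil
  then show ?case by (intro exI[of _ t]) simp
next
  case (Cons X Xs)
  then obtain u where u: "pconf D R H u" "nodes t \<subseteq> nodes u" "nodes u \<inter> F = {}"
    "\<forall>q \<in> nodes t. lbl u q = lbl t q" "child_labels u p = mset Xs + child_labels t p"
    "\<forall>q \<in> nodes t - {p}. child_labels u q = child_labels t q" by auto
  have T: "is_tree u" using u(1) by (rule pconf_is_tree)
  obtain s :: "('l, 'n) xtree" where s: "pconf D X {} s" "nodes s \<inter> (F \<union> nodes u) = {}"
    using Cons.prems(1)[of X "F \<union> nodes u"] Cons.prems(6) is_treeD(1)[OF T] by auto
  have d: "nodes s \<inter> nodes u = {}" and p: "p \<in> nodes u" "lbl u p \<noteq> Str"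
    and l: "lbl s (root s) = X" and S: "is_tree s"
    using s u Cons.prems by (auto simp: pconf_def)
  show ?case
  proof (intro exI[of _ "apply_upd u (Ins p s)"] conjI)
    show "pconf D R H (apply_upd u (Ins p s))"
      using pconf_Ins[OF u(1) s(1) p(1) Cons.prems(3) p(2) d] by simp
    show "\<forall>q \<in> nodes t. lbl (apply_upd u (Ins p s)) q = lbl t q" using u(2,4) d by auto
    show "child_labels (apply_upd u (Ins p s)) p = mset (X # Xs) + child_labels t p"
      unfolding child_labels_Ins[OF T S p(1) d] using u(5) l by simp
    have "q \<notin> nodes s" if "q \<in> nodes t" for q using that u(2) d by blast
    then show "\<forall>q \<in> nodes t - {p}. child_labels (apply_upd u (Ins p s)) q = child_labels t q"
      unfolding child_labels_Ins[OF T S p(1) d] using u(6) by auto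
  qed (use u s in auto)
qed

lemma lang_ok_exists: "rg_wf r \<Longrightarrow> \<exists>Xs. lang_ok r (mset Xs) \<and> set Xs \<subseteq> El ` subelems r \<union> {Str}"
proof (cases r)
  case (RConc Bs)
  then show ?thesis by (intro exI[of _ "map El Bs"]) auto
next
  case (RDisj Bs)
  assume "rg_wf r"
  with RDisj show ?thesis by (intro exI[of _ "[El (hd Bs)]"]) auto
qed (force intro: exI[of _ "[Str]"] exI[of _ "[]"])+

text \<open>Provides the siblings that must accompany a chosen child \<open>B\<close> when a tree is
  continued downwards through it.\<close>

lemma lang_ok_exists_with:
  assumes "rg_wf r" "B \<in> subelems r"
  shows "\<exists>Xs. lang_ok r (add_mset (El B) (mset Xs)) \<and> set Xs \<subseteq> El ` subelems r \<union> {Str}"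
proof (cases r)
  case (RConc Bs)
  have "mset (map El Bs) = add_mset (El B) (mset (map El (remove1 B Bs)))"
    using assms RConc by (simp flip: image_mset_add_mset)
  moreover have "set (map El (remove1 B Bs)) \<subseteq> El ` subelems r"
    using RConc set_remove1_subset[of B Bs] by auto
  ultimately show ?thesis using RConc by (intro exI[of _ "map El (remove1 B Bs)"]) auto
qed (use assms in \<open>auto intro: exI[of _ "[]"]\<close>)

text \<open>A one-hole context. The hole is still childless, so exactly one word of
  \<open>Rg D A\<close> has to be supplied below it.\<close>

definition hole :: "'l dtd \<Rightarrow> 'l \<Rightarrow> 'l \<Rightarrow> 'n \<Rightarrow> ('l, 'n) xtree \<Rightarrow> bool" where
  "hole D R A p t \<longleftrightarrow>
     pconf D (El R) {p} t \<and> p \<in> nodes t \<and> lbl t p = El A \<and> child_labels t p = {#}"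

lemma hole_is_tree: "hole D R A p t \<Longrightarrow> is_tree t"
  by (auto simp: hole_def pconf_def)

lemma hole_fill:
  assumes h: "hole D R A p t" and s: "pconf D X {} s" and d: "nodes s \<inter> nodes t = {}"
    and l: "lang_ok (Rg D A) {#X#}"
  shows "conforms D R (apply_upd t (Ins p s))"
proof (rule conforms_close)
  have p: "p \<in> nodes t" "lbl t p = El A" "pconf D (El R) {p} t" "child_labels t p = {#}"
    using h by (auto simp: hole_def)
  show "pconf D (El R) {p} (apply_upd t (Ins p s))"
    using pconf_Ins[OF p(3) s p(1) _ _ d] p(2) by simp
  show "lbl (apply_upd t (Ins p s)) p = El A" using p d by auto
  show "lang_ok (Rg D A) (child_labels (apply_upd t (Ins p s)) p)"
    using child_labels_Ins[OF hole_is_tree[OF h] pconf_is_tree[OF s] p(1) d, of p] p(4) l s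
    by (simp add: pconf_def)
qed

lemma hole_conforms:
  assumes "hole D R A p t" "lang_ok (Rg D A) {#}"
  shows "conforms D R t"
  using assms conforms_close[of D R p t A] by (simp add: hole_def)

context
  fixes D :: "'l dtd"
  assumes dtd: "is_dtd D" and inf: "infinite (UNIV :: 'n set)"
begin

lemma dtd_rg: "A \<in> Ele D \<Longrightarrow> rg_wf (Rg D A)" "A \<in> Ele D \<Longrightarrow> subelems (Rg D A) \<subseteq> Ele D"
  using dtd by (auto simp: is_dtd_def)

lemma pconf_Str_exists:
  "finite F \<Longrightarrow> \<exists>s :: ('l, 'n) xtree. pconf D Str {} s \<and> nodes s \<inter> F = {}"
proof -
  assume "finite F"
  then obtain n :: 'n where "n \<notin> F" using ex_new_if_finite[OF inf] by blast
  then show ?thesis by (intro exI[of _ "leaf n Str"]) (simp add: pconf_leaf_Str)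
qed

text \<open>A finite acyclic relation has a well-founded converse, so induction passes from
  subelement types to their parents: a root leaf receives trees from the induction hypothesis as
  children. Avoiding \<open>F\<close> keeps the pieces disjoint.\<close>

lemma conforms_exists:
  "A \<in> Ele D \<Longrightarrow> finite F \<Longrightarrow> \<exists>s :: ('l, 'n) xtree. conforms D A s \<and> nodes s \<inter> F = {}"
proof -
  have "wf ((sub_rel D)\<inverse>)"
    using finite_acyclic_wf_converse[OF finite_sub_rel[OF dtd]] dtd by (simp add: is_dtd_def)
  then show "A \<in> Ele D \<Longrightarrow> finite F \<Longrightarrow> ?thesis"
  proof (induction A arbitrary: F rule: wf_induct_rule)
    case (less A)
    obtain Xs where Xs: "lang_ok (Rg D A) (mset Xs)" "set Xs \<subseteq> El ` subelems (Rg D A) \<union> {Str}"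
      using lang_ok_exists dtd_rg less.prems by blast
    obtain n where n: "n \<notin> F" using ex_new_if_finite[OF inf less.prems(2)] by blast
    have ex: "\<exists>s :: ('l, 'n) xtree. pconf D X {} s \<and> nodes s \<inter> F = {}"
      if "X \<in> set Xs" "finite F" for X F
    proof (cases X)
      case (El B)
      then have "(A, B) \<in> sub_rel D" "B \<in> Ele D"
        using that Xs(2) less.prems(1) dtd_rg(2) by (auto simp: sub_rel_def)
      then show ?thesis using less.IH[of B F] that(2) El by (simp add: conforms_iff_pconf)
    next
      case Str
      then show ?thesis using pconf_Str_exists that by simp
    qed
    have "pconf D (El A) {n} (leaf n (El A) :: ('l, 'n) xtree)"
      using less.prems by (intro pconf_leaf) simp
    from pconf_add_children[where Xs = Xs and p = n and F = F, OF ex this] n less.prems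
    obtain u :: "('l, 'n) xtree" where
      "pconf D (El A) {n} u" "nodes u \<inter> F = {}" "lbl u n = El A" "child_labels u n = mset Xs"
      by auto
    then show ?case using conforms_close Xs(1) by metis
  qed
qed

lemma pconf_exists:
  assumes "A \<in> Ele D" "X \<in> El ` subelems (Rg D A) \<union> {Str}" "finite F"
  shows "\<exists>s :: ('l, 'n) xtree. pconf D X {} s \<and> nodes s \<inter> F = {}"
  using assms conforms_exists[OF _ assms(3)] pconf_Str_exists[OF assms(3)] dtd_rg(2)[OF assms(1)]
  by (auto simp: conforms_iff_pconf)

text \<open>Induction along a path from \<open>R\<close> to \<open>A\<close>: the hole
  \<open>p\<close> gets a new leaf \<open>q\<close> of the next type together with the siblings its
  production requires, and \<open>q\<close> becomes the hole.\<close>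

lemma hole_exists:
  assumes "(R, A) \<in> le_D D" "R \<in> Ele D" "finite F"
  shows "\<exists>(t :: ('l, 'n) xtree) p. hole D R A p t \<and> nodes t \<inter> F = {}"
  using assms(1) unfolding le_D_def
proof (induction rule: rtrancl_induct)
  case base
  obtain n where "n \<notin> F" using ex_new_if_finite[OF inf assms(3)] by blast
  then show ?case
    using pconf_leaf[of "El R" D n] assms(2)
    by (intro exI[of _ "leaf n (El R)"] exI[of _ n]) (simp add: hole_def)
next
  case (step A B)
  then obtain t p where t: "hole D R A p t" "nodes t \<inter> F = {}" by blast
  then have tp: "pconf D (El R) {p} t" "p \<in> nodes t" "lbl t p = El A" "child_labels t p = {#}"
    by (auto simp: hole_def)
  have T: "is_tree t" using tp(1) by (rule pconf_is_tree)
  have A: "A \<in> Ele D" "B \<in> subelems (Rg D A)" "B \<in> Ele D"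
    using step.hyps(2) dtd_rg(2)[of A] by (auto simp: sub_rel_def)
  obtain Xs where Xs: "lang_ok (Rg D A) (add_mset (El B) (mset Xs))"
    "set Xs \<subseteq> El ` subelems (Rg D A) \<union> {Str}"
    using lang_ok_exists_with[OF dtd_rg(1)[OF A(1)] A(2)] by blast
  have "finite (F \<union> nodes t)" using assms(3) is_treeD(1)[OF T] by simp
  then obtain q where q: "q \<notin> F" "q \<notin> nodes t" using ex_new_if_finite[OF inf] by blast
  let ?l = "leaf q (El B) :: ('l, 'n) xtree" and ?u = "apply_upd t (Ins p (leaf q (El B)))"
  have d: "nodes ?l \<inter> nodes t = {}" using q by simp
  have l: "pconf D (El B) {q} ?l" using A(3) by (intro pconf_leaf) simp
  \<comment> \<open>Two holes for a moment: \<open>p\<close> until its remaining children arrive,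
    \<open>q\<close> from now on.\<close>
  have u: "pconf D (El R) {p, q} ?u"
    using pconf_Ins[OF tp(1) l tp(2) _ _ d] tp(3) by (simp add: insert_commute)
  note cl = child_labels_Ins[OF T is_tree_leaf tp(2) d]
  have pq: "p \<noteq> q" using tp(2) q by blast
  have "\<exists>w. pconf D (El R) {p, q} w \<and> nodes ?u \<subseteq> nodes w \<and> nodes w \<inter> F = {}
    \<and> (\<forall>q \<in> nodes ?u. lbl w q = lbl ?u q) \<and> child_labels w p = mset Xs + child_labels ?u p
    \<and> (\<forall>q \<in> nodes ?u - {p}. child_labels w q = child_labels ?u q)"
    by (rule pconf_add_children[OF _ u])
      (use pconf_exists[OF A(1)] Xs(2) tp q t(2) assms(3) in auto)
  then obtain w where w: "pconf D (El R) {p, q} w" "nodes ?u \<subseteq> nodes w" "nodes w \<inter> F = {}"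
    "\<forall>q \<in> nodes ?u. lbl w q = lbl ?u q" "child_labels w p = mset Xs + child_labels ?u p"
    "\<forall>q \<in> nodes ?u - {p}. child_labels w q = child_labels ?u q" by blast
  have "lbl w p = El A" "lbl w q = El B" "q \<in> nodes w" using w(2,4) tp pq by auto
  moreover have "child_labels w q = {#}" using w(6) pq cl[of q] by simp
  moreover have "lang_ok (Rg D A) (child_labels w p)"
    using w(5) cl[of p] tp(4) Xs(1) by simp
  ultimately have "hole D R B q w" using pconf_close[OF w(1)] by (simp add: hole_def)
  then show ?case using w(3) by blast
qed

end

section \<open>Simulation of forbidden updates\<close>

text \<open>The hole at the element type of \<open>u\<close> is filled with just what
  \<open>u\<close> edits. Both the tree and its updated version avoid \<open>F\<close>, so either
  can be grafted into a context with node set \<open>F\<close>; the last clause makes string updates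
  non-trivial.\<close>

lemma probe_exists:
  fixes D :: "'l dtd"
  assumes dtd: "is_dtd D" and inf: "infinite (UNIV :: 'n set)"
    and u: "u \<in> valid D" and B: "(B, uat_elem u) \<in> le_D D" "B \<in> Ele D" and F: "finite F"
  shows "\<exists>(s :: ('l, 'n) xtree) op. conforms D B s \<and> matches D s op u \<and> valid_upd s op
    \<and> nodes s \<inter> F = {} \<and> nodes (apply_upd s op) \<inter> F = {}
    \<and> (\<forall>n x. op = RepS n x \<longrightarrow> val s n \<noteq> x)"
proof -
  obtain c :: "('l, 'n) xtree" and p where h: "hole D B (uat_elem u) p c" and c: "nodes c \<inter> F = {}"
    using hole_exists[OF dtd inf B F] by blast
  have T: "is_tree c" using h by (rule hole_is_tree)
  have p: "p \<in> nodes c" "lbl c p = El (uat_elem u)" using h by (auto simp: hole_def)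
  have sub: "Z \<in> Ele D" if "(uat_elem u, Z) \<in> sub_rel D" for Z
    using that dtd by (auto simp: sub_rel_def is_dtd_def)
  have fin: "finite (F \<union> nodes c)" using F is_treeD(1)[OF T] by simp
  show ?thesis
  proof (cases u)
    case (UIns C Z)
    obtain r :: "('l, 'n) xtree" where r: "conforms D Z r" "nodes r \<inter> (F \<union> nodes c) = {}"
      using conforms_exists[OF dtd inf sub fin, of Z] valid_sub_rel(1)[of C Z D] u UIns by auto
    have "conforms D B c" by (rule hole_conforms[OF h]) (use u UIns in \<open>simp add: valid_def\<close>)
    then show ?thesis
      using r c p UIns by (intro exI[of _ c] exI[of _ "Ins p r"]) (auto simp: I_D_def)
  next
    case (UDel C Z)
    obtain r :: "('l, 'n) xtree" where r: "conforms D Z r" "nodes r \<inter> (F \<union> nodes c) = {}"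
      using conforms_exists[OF dtd inf sub fin, of Z] valid_sub_rel(2)[of C Z D] u UDel by auto
    have d: "nodes r \<inter> nodes c = {}" "p \<notin> nodes r" using r(2) p by blast+
    have R: "is_tree r" using r(1) by (rule conforms_is_tree)
    have cf: "conforms D B (apply_upd c (Ins p r))"
      using r(1) u UDel unfolding conforms_iff_pconf[of D Z]
      by (intro hole_fill[OF h _ d(1)]) (auto simp: valid_def)
    have "lbl r (root r) = El Z" using r(1) by (simp add: conforms_def)
    then have "matches D (apply_upd c (Ins p r)) (Del (root r)) u"
      using parent_graft[OF T R p(1) d(1)] is_treeD(2)[OF R] p(2) d(2) UDel by simp
    then show ?thesis using cf r c is_treeD(2)[OF R]
      by (intro exI[of _ "apply_upd c (Ins p r)"] exI[of _ "Del (root r)"]) auto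
  next
    case (URep C X Y)
    obtain r :: "('l, 'n) xtree" where r: "conforms D X r" "nodes r \<inter> (F \<union> nodes c) = {}"
      using conforms_exists[OF dtd inf sub fin, of X] valid_sub_rel(3)[of C X Y D] u URep by auto
    have R: "is_tree r" using r(1) by (rule conforms_is_tree)
    have "finite (F \<union> nodes c \<union> nodes r)" using fin is_treeD(1)[OF R] by simp
    then obtain r' :: "('l, 'n) xtree" where r': "conforms D Y r'"
      "nodes r' \<inter> (F \<union> nodes c \<union> nodes r) = {}"
      using conforms_exists[OF dtd inf sub, of Y "F \<union> nodes c \<union> nodes r"] valid_sub_rel(4)[of C X Y D]
        u URep by auto
    have d: "nodes r \<inter> nodes c = {}" "p \<notin> nodes r" using r(2) p by blast+
    have cf: "conforms D B (apply_upd c (Ins p r))"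
      using r(1) u URep unfolding conforms_iff_pconf[of D X]
      by (intro hole_fill[OF h _ d(1)]) (auto simp: valid_def)
    have "lbl r (root r) = El X" using r(1) by (simp add: conforms_def)
    moreover have "X \<noteq> Y" using u URep by (simp add: valid_def)
    ultimately have "matches D (apply_upd c (Ins p r)) (Rep (root r) r') u"
      using parent_graft[OF T R p(1) d(1)] is_treeD(2)[OF R] p(2) d(2) URep r'(1)
      by (simp add: I_D_def)
    moreover have "valid_upd (apply_upd c (Ins p r)) (Rep (root r) r')"
      using r' is_treeD(2)[OF R] by auto
    moreover have "nodes (apply_upd (apply_upd c (Ins p r)) (Rep (root r) r')) \<inter> F = {}"
      using r r' c by (auto simp: Rep_eq_Del_Ins)
    ultimately show ?thesis using cf r c
      by (intro exI[of _ "apply_upd c (Ins p r)"] exI[of _ "Rep (root r) r'"]) auto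
  next
    case (URepS C)
    obtain q where q: "q \<notin> F \<union> nodes c" using ex_new_if_finite[OF inf fin] by blast
    let ?r = "leaf q Str :: ('l, 'n) xtree"
    have d: "nodes ?r \<inter> nodes c = {}" "p \<noteq> q" using q p by auto
    have cf: "conforms D B (apply_upd c (Ins p ?r))"
      using u URepS by (intro hole_fill[OF h pconf_leaf_Str d(1)]) (auto simp: valid_def)
    \<comment> \<open>A leaf carries the empty string, so any nonempty string is a real
      change.\<close>
    have "matches D (apply_upd c (Ins p ?r)) (RepS q ''a'') u"
      using parent_graft[OF T is_tree_leaf p(1) d(1)] p(2) d(2) URepS by simp
    then show ?thesis using cf q c
      by (intro exI[of _ "apply_upd c (Ins p ?r)"] exI[of _ "RepS q ''a''"]) auto
  qed
qed

text \<open>The profile at the element type is invariant under isomorphism and always changes: in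
  size for insertions and deletions, by exchange of distinct labels or distinct strings for
  replacements.\<close>

lemma upd_nontrivial:
  assumes D: "is_dtd D" and t: "conforms D R t" and u: "u \<in> valid D" and m: "matches D t op u"
    and va: "valid_upd t op" and x: "\<And>n x. op = RepS n x \<Longrightarrow> val t n \<noteq> x"
  shows "\<not> iso (apply_upd t op) t"
proof
  assume i: "iso (apply_upd t op) t"
  let ?C = "uat_elem u"
  have T: "is_tree t" using t by (rule conforms_is_tree)
  have "is_tree (apply_upd t op)"
    by (rule conforms_is_tree[OF conforms_apply_upd[OF t u m va]])
  from profile_cong_iso[OF this T i] have eq: "profile t ?C = profile (apply_upd t op) ?C" .
  have "(?C, ?C) \<notin> (sub_rel D)\<^sup>+" using D by (simp add: is_dtd_def acyclic_def)
  from apply_upd_effect(2)[OF t u m va pop_apply_upd[OF t u m va this] refl]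
  have e: "effect u (profile t ?C) (profile t ?C)" using eq by simp
  show False
  proof (cases u)
    case (URep A X Y)
    then have "X \<noteq> Y" using u by (simp add: valid_def)
    then show False using e URep by auto
  next
    case (URepS A)
    obtain n x where op: "op = RepS n x" "lbl t n = Str" "has_parent t n"
      "lbl t (parent t n) = El A"
      using m URepS by (cases rule: matches_cases) auto
    from profile_RepS(2)[OF T has_parentD(1)[OF T op(3)] op(2,4), of x]
    obtain N where "profile t A = add_mset (Str, val t n) N"
      "profile (apply_upd t op) A = add_mset (Str, x) N" using op(1) by blast
    then show False using eq URepS x[OF op(1)] by simp
  qed (use e in auto)
qed

lemma not_consistentI:
  fixes t :: "('l, 'n) xtree"
  assumes D: "is_dtd D" and P: "is_policy D P" and t: "conforms D (rt D) t"
    and ops: "ops \<noteq> []" "allowed D (fst P) t ops" and u: "u \<in> snd P" and m: "matches D t op u"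
    and va: "valid_upd t op" and x: "\<And>n x. op = RepS n x \<Longrightarrow> val t n \<noteq> x"
    and a: "agree (apply_seq t ops) (apply_upd t op)"
  shows "\<not> consistent D P TYPE('n)"
proof -
  have "u \<in> valid D" using P u by (auto simp: is_policy_def)
  then have "\<not> iso (apply_upd t op) t" by (rule upd_nontrivial[OF D t _ m va x])
  moreover have "op \<in> sem D (snd P) t" using u m by (auto simp: sem_def)
  ultimately show ?thesis
    using t ops va agree_iso[OF a] unfolding consistent_def I_D_def by blast
qed

lemma allowed_append:
  "allowed D S t (xs @ ys) \<longleftrightarrow> allowed D S t xs \<and> allowed D S (apply_seq t xs) ys"
  by (induction xs arbitrary: t) (auto simp: apply_seq_def)

lemma replace_step:
  assumes G: "(X, Y) \<in> G_A D A S" and S: "S \<subseteq> valid D"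
    and t: "is_tree t" "p \<in> nodes t" "lbl t p = El A"
    and s: "conforms D X s" "nodes s \<inter> nodes t = {}"
    and s': "conforms D Y s'" "nodes s' \<inter> nodes t = {}" "nodes s' \<inter> nodes s = {}"
    and w: "agree w (apply_upd t (Ins p s))"
  shows "allowed D S w [Rep (root s) s']"
    and "agree (apply_seq w [Rep (root s) s']) (apply_upd t (Ins p s'))"
proof -
  have u: "URep A X Y \<in> S" "X \<noteq> Y" using G S by (auto simp: G_A_def valid_def)
  have ts: "is_tree s" "root s \<in> nodes s" "lbl s (root s) = El X"
    using s(1) by (auto simp: conforms_def is_treeD(2))
  note pg = parent_graft[OF t(1) ts(1) t(2) s(2)]
  have "p \<notin> nodes s" using t(2) s(2) by blast
  then have "lbl w p = El A" "lbl w (root s) = El X" "nodes w = nodes t \<union> nodes s"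
    using w t ts by (auto simp: agree_def)
  then have "matches D w (Rep (root s) s') (URep A X Y)"
    using agree_parent[OF w, of "root s"] agree_has_parent[OF w, of "root s"] pg s'(1) u(2)
    by (simp add: I_D_def del: apply_upd.simps)
  moreover have "valid_upd w (Rep (root s) s')"
    using \<open>nodes w = _\<close> ts(2) s' by auto
  ultimately show "allowed D S w [Rep (root s) s']" using u(1)
    unfolding allowed.simps sem_def by blast
  show "agree (apply_seq w [Rep (root s) s']) (apply_upd t (Ins p s'))"
    using Rep_graft[OF w t(1) ts(1) t(2) s(2)] by (simp add: apply_seq_def del: apply_upd.simps)
qed

text \<open>One replacement per edge of the path. Intermediate vertices receive fresh trees, and
  only the last tree is prescribed, so the induction is general in \<open>s'\<close>.\<close>

lemma replace_path:
  fixes D :: "'l dtd" and t :: "('l, 'n) xtree"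
  assumes dtd: "is_dtd D" and inf: "infinite (UNIV :: 'n set)"
    and A: "A \<in> Ele D" and S: "S \<subseteq> valid D" and G: "(X, Y) \<in> (G_A D A S)\<^sup>+"
    and t: "is_tree t" "p \<in> nodes t" "lbl t p = El A"
    and s: "conforms D X s" "nodes s \<inter> nodes t = {}"
    and s': "conforms D Y s'" "nodes s' \<inter> nodes t = {}" "nodes s' \<inter> nodes s = {}"
    and w: "agree w (apply_upd t (Ins p s))"
  shows "\<exists>ops. ops \<noteq> [] \<and> allowed D S w ops \<and> agree (apply_seq w ops) (apply_upd t (Ins p s'))"
  using G s'
proof (induction arbitrary: s' rule: trancl_induct)
  case (base Y)
  then show ?case using replace_step[OF base(1) S t s base(2-4) w] by blast
next
  case (step Y Z)
  have "Y \<in> Ele D" using step.hyps(2) A dtd by (fastforce simp: G_A_def is_dtd_def)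
  moreover have "finite (nodes t \<union> nodes s \<union> nodes s')"
    using t s step.prems by (auto simp: conforms_def is_treeD(1))
  ultimately obtain r :: "('l, 'n) xtree" where
    r: "conforms D Y r" "nodes r \<inter> (nodes t \<union> nodes s \<union> nodes s') = {}"
    using conforms_exists[OF dtd inf, of Y "nodes t \<union> nodes s \<union> nodes s'"] by blast
  obtain ops where ops: "ops \<noteq> []" "allowed D S w ops"
    "agree (apply_seq w ops) (apply_upd t (Ins p r))"
    using step.IH[OF r(1)] r(2) by blast
  have "nodes r \<inter> nodes t = {}" "nodes s' \<inter> nodes r = {}" using r(2) by blast+
  from replace_step[OF step.hyps(2) S t r(1) this(1) step.prems(1,2) this(2) ops(3)] ops
  show ?case
    by (intro exI[of _ "ops @ [Rep (root r) s']"])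
      (auto simp: allowed_append apply_seq_def simp del: apply_upd.simps)
qed

text \<open>A valid \<open>URep\<close> has distinct types, so there are no loops and a cycle visits
  a second vertex. The detour is essential later: the updated tree may share nodes with the tree it
  replaces, so a disjoint tree at \<open>Y\<close> has to come in between.\<close>

lemma G_A_cycle_split:
  assumes "S \<subseteq> valid D" "(X, X) \<in> (G_A D A S)\<^sup>+"
  obtains Y where "(X, Y) \<in> G_A D A S" "(Y, X) \<in> (G_A D A S)\<^sup>+"
proof -
  obtain Y where Y: "(X, Y) \<in> G_A D A S" "(Y, X) \<in> (G_A D A S)\<^sup>*"
    using assms(2) by (meson tranclD)
  moreover have "X \<noteq> Y" using Y(1) assms(1) by (auto simp: G_A_def valid_def)
  ultimately show ?thesis using that by (auto simp: rtrancl_eq_or_trancl)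
qed

lemma consistent_imp_T_disjoint:
  fixes D :: "'l dtd"
  assumes inf: "infinite (UNIV :: 'n set)" and D: "is_dtd D" and P: "is_policy D P"
    and c: "consistent D P TYPE('n)"
  shows "T_op D (fst P) \<inter> snd P = {}"
proof (rule ccontr)
  assume "T_op D (fst P) \<inter> snd P \<noteq> {}"
  then obtain u where uT: "u \<in> T_op D (fst P)" and uF: "u \<in> snd P" by blast
  have S: "fst P \<subseteq> valid D" and u: "u \<in> valid D" "u \<notin> fst P"
    using P uF by (auto simp: is_policy_def)
  have rt: "(rt D, A) \<in> le_D D" if "A \<in> Ele D" for A using D that by (simp add: is_dtd_def)
  have rtE: "rt D \<in> Ele D" using D by (simp add: is_dtd_def)
  have sub: "B \<in> Ele D" if "A \<in> Ele D" "B \<in> subelems (Rg D A)" for A B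
    using D that by (auto simp: is_dtd_def)
  \<comment> \<open>The criterion as a refutation rule, with the assumed consistency
    \<open>c\<close> already supplied.\<close>
  note contra = not_consistentI[OF D P, where u = u, THEN notE[where R = False],
      OF _ _ _ uF _ _ _ _ c]
  consider (star) A B where "A \<in> Ele D" "Rg D A = RStar B" "UIns A B \<in> fst P"
      "UDel A B \<in> fst P" "(B, uat_elem u) \<in> le_D D"
    | (cycle) A Bs B where "A \<in> Ele D" "Rg D A = RDisj Bs" "B \<in> set Bs"
      "(B, B) \<in> (G_A D A (fst P))\<^sup>+" "(B, uat_elem u) \<in> le_D D"
    | (path) A Bs X Y where "u = URep A X Y" "A \<in> Ele D" "Rg D A = RDisj Bs" "X \<in> set Bs"
      "Y \<in> set Bs" "(X, Y) \<in> (G_A D A (fst P))\<^sup>+"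
    using uT u(2) unfolding T_op_def by blast
  then show False
  proof cases
    case (star A B)
    obtain t :: "('l, 'n) xtree" and p where h: "hole D (rt D) A p t"
      using hole_exists[OF D inf rt[OF star(1)] rtE, of "{}"] by blast
    have T: "is_tree t" using h by (rule hole_is_tree)
    have p: "p \<in> nodes t" "lbl t p = El A" using h by (auto simp: hole_def)
    obtain s :: "('l, 'n) xtree" and op where s: "conforms D B s" "matches D s op u"
      "valid_upd s op" "nodes s \<inter> nodes t = {}" "nodes (apply_upd s op) \<inter> nodes t = {}"
      "\<forall>n x. op = RepS n x \<longrightarrow> val s n \<noteq> x"
      using probe_exists[OF D inf u(1) star(5) sub[OF star(1)] is_treeD(1)[OF T]] star(2) by auto
    have ts: "is_tree s" "root s \<in> nodes s" "lbl s (root s) = El B"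
      using s(1) by (auto simp: conforms_def is_treeD(2))
    let ?t = "apply_upd t (Ins p s)" and ?s = "apply_upd s op"
    \<comment> \<open>The subtree is deleted and comes back already updated; it may reuse the node
      names that the deletion has released.\<close>
    let ?ops = "[Del (root s), Ins p ?s]"
    have ct: "conforms D (rt D) ?t"
      using s(1) star(2) unfolding conforms_iff_pconf[of D B]
      by (intro hole_fill[OF h _ s(4)]) auto
    note g = upd_in_graft[OF T ts(1) p(1) s(4,5,2,3)]
    have d: "agree (apply_upd ?t (Del (root s))) t" by (rule Del_graft[OF T ts(1) p(1) s(4)])
    have "p \<notin> nodes s" using p s(4) by blast
    then have "matches D ?t (Del (root s)) (UDel A B)"
      using parent_graft[OF T ts(1) p(1) s(4)] ts p(2) by simp
    moreover have "valid_upd ?t (Del (root s))" using ts(2) by simp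
    moreover have "valid_upd (apply_upd ?t (Del (root s))) (Ins p ?s)"
      using d p s(5) unfolding agree_def by (simp del: apply_upd.simps nodes_Del)
    moreover have "matches D (apply_upd ?t (Del (root s))) (Ins p ?s) (UIns A B)"
      using d p conforms_apply_upd[OF s(1) u(1) s(2,3)] unfolding agree_def
      by (simp add: I_D_def del: apply_upd.simps Del_sels)
    ultimately have al: "allowed D (fst P) ?t ?ops"
      using star(3,4) unfolding allowed.simps sem_def by blast
    have ag: "agree (apply_seq ?t ?ops) (apply_upd ?t op)"
      using agree_trans[OF agree_Ins[OF d] agree_sym[OF g(3)]]
      by (simp add: apply_seq_def del: apply_upd.simps)
    have "val ?t n \<noteq> x" if "op = RepS n x" for n x
      using that s(3,6) by simp
    then show False by (intro contra[OF ct _ al g(1,2) _ ag]) (simp_all del: apply_upd.simps)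
  next
    case (cycle A Bs B)
    obtain t :: "('l, 'n) xtree" and p where h: "hole D (rt D) A p t"
      using hole_exists[OF D inf rt[OF cycle(1)] rtE, of "{}"] by blast
    have T: "is_tree t" using h by (rule hole_is_tree)
    have p: "p \<in> nodes t" "lbl t p = El A" using h by (auto simp: hole_def)
    obtain s :: "('l, 'n) xtree" and op where s: "conforms D B s" "matches D s op u"
      "valid_upd s op" "nodes s \<inter> nodes t = {}" "nodes (apply_upd s op) \<inter> nodes t = {}"
      "\<forall>n x. op = RepS n x \<longrightarrow> val s n \<noteq> x"
      using probe_exists[OF D inf u(1) cycle(5) sub[OF cycle(1)] is_treeD(1)[OF T]] cycle(2,3)
      by auto
    have ts: "is_tree s" by (rule conforms_is_tree[OF s(1)])
    let ?t = "apply_upd t (Ins p s)" and ?s = "apply_upd s op"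
    have cs: "conforms D B ?s" by (rule conforms_apply_upd[OF s(1) u(1) s(2,3)])
    have ct: "conforms D (rt D) ?t"
      using s(1) cycle(2,3) unfolding conforms_iff_pconf[of D B]
      by (intro hole_fill[OF h _ s(4)]) auto
    note g = upd_in_graft[OF T ts p(1) s(4,5,2,3)]
    \<comment> \<open>The first edge leads from \<open>s\<close> to a fresh tree \<open>r\<close>,
      the remaining path from \<open>r\<close> to the updated tree \<open>?s\<close>.\<close>
    obtain Y where Y: "(B, Y) \<in> G_A D A (fst P)" "(Y, B) \<in> (G_A D A (fst P))\<^sup>+"
      using G_A_cycle_split[OF S cycle(4)] .
    have "Y \<in> Ele D" using Y(1) sub[OF cycle(1)] by (auto simp: G_A_def)
    moreover have "finite (nodes t \<union> nodes s \<union> nodes ?s)"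
      using T ts conforms_is_tree[OF cs] is_treeD(1) by blast
    ultimately obtain r :: "('l, 'n) xtree" where
      r: "conforms D Y r" "nodes r \<inter> (nodes t \<union> nodes s \<union> nodes ?s) = {}"
      using conforms_exists[OF D inf, of Y "nodes t \<union> nodes s \<union> nodes ?s"] by blast
    then have rd: "nodes r \<inter> nodes t = {}" "nodes r \<inter> nodes s = {}" "nodes ?s \<inter> nodes r = {}"
      by blast+
    note st = replace_step[OF Y(1) S T p s(1,4) r(1) rd(1,2) agree_refl]
    obtain ops where ops: "allowed D (fst P) (apply_seq ?t [Rep (root s) r]) ops"
      "agree (apply_seq (apply_seq ?t [Rep (root s) r]) ops) (apply_upd t (Ins p ?s))"
      using replace_path[OF D inf cycle(1) S Y(2) T p r(1) rd(1) cs s(5) rd(3) st(2)] by blast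
    have al: "allowed D (fst P) ?t ([Rep (root s) r] @ ops)"
      using st(1) ops(1) by (simp only: allowed_append)
    have ag: "agree (apply_seq ?t ([Rep (root s) r] @ ops)) (apply_upd ?t op)"
      using agree_trans[OF ops(2) agree_sym[OF g(3)]]
      by (simp add: apply_seq_def del: apply_upd.simps)
    have "val ?t n \<noteq> x" if "op = RepS n x" for n x
      using that s(3,6) by simp
    then show False by (intro contra[OF ct _ al g(1,2) _ ag]) (simp_all del: apply_upd.simps)
  next
    case (path A Bs X Y)
    obtain t :: "('l, 'n) xtree" and p where h: "hole D (rt D) A p t"
      using hole_exists[OF D inf rt[OF path(2)] rtE, of "{}"] by blast
    have T: "is_tree t" using h by (rule hole_is_tree)
    have p: "p \<in> nodes t" "lbl t p = El A" using h by (auto simp: hole_def)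
    obtain s :: "('l, 'n) xtree" where s: "conforms D X s" "nodes s \<inter> nodes t = {}"
      using conforms_exists[OF D inf sub[OF path(2)] is_treeD(1)[OF T]] path(3,4) by auto
    have ts: "is_tree s" by (rule conforms_is_tree[OF s(1)])
    have "finite (nodes t \<union> nodes s)" using T ts is_treeD(1) by blast
    then obtain r :: "('l, 'n) xtree" where r: "conforms D Y r" "nodes r \<inter> (nodes t \<union> nodes s) = {}"
      using conforms_exists[OF D inf sub[OF path(2)], of Y "nodes t \<union> nodes s"] path(3,5) by auto
    then have rd: "nodes r \<inter> nodes t = {}" "nodes r \<inter> nodes s = {}" by blast+
    let ?t = "apply_upd t (Ins p s)"
    have ct: "conforms D (rt D) ?t"
      using s(1) path(3,4) unfolding conforms_iff_pconf[of D X]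
      by (intro hole_fill[OF h _ s(2)]) auto
    \<comment> \<open>The forbidden replacement is the one-step path allowed by \<open>{u}\<close>.\<close>
    have "(X, Y) \<in> G_A D A {u}" "{u} \<subseteq> valid D" using path u by (auto simp: G_A_def)
    note st = replace_step[OF this T p s r(1) rd agree_refl]
    obtain ops where ops: "ops \<noteq> []" "allowed D (fst P) ?t ops"
      "agree (apply_seq ?t ops) (apply_upd t (Ins p r))"
      using replace_path[OF D inf path(2) S path(6) T p s r(1) rd agree_refl] by blast
    have "agree (apply_seq ?t ops) (apply_upd ?t (Rep (root s) r))"
      using agree_trans[OF ops(3) agree_sym[OF st(2)]]
      by (simp add: apply_seq_def del: apply_upd.simps)
    moreover have "matches D ?t (Rep (root s) r) u" "valid_upd ?t (Rep (root s) r)"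
      using st(1) by (simp_all add: sem_def del: apply_upd.simps)
    ultimately show False by (intro contra[OF ct ops(1,2)]) auto
  qed
qed

section \<open>Equivalence of the three conditions\<close>

theorem theorem2:
  fixes D :: "'l dtd" and P :: "'l policy"
  assumes "infinite (UNIV :: 'l set)"
    and "infinite (UNIV :: 'n set)"
    and "is_dtd D"
    and "is_policy D P"
  shows "(quasiconsistent D P TYPE('n) \<longleftrightarrow> consistent D P TYPE('n))
       \<and> (consistent D P TYPE('n) \<longleftrightarrow> T_op D (fst P) \<inter> snd P = {})"
proof -
  have "consistent D P TYPE('n)" if q: "quasiconsistent D P TYPE('n)"
  proof -
    obtain Q where Q: "fst P \<subseteq> fst Q" "snd P \<subseteq> snd Q" "consistent D Q TYPE('n)"
      using q by (auto simp: quasiconsistent_def info_le_def)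
    \<comment> \<open>An extension allows more sequences and forbids more updates, so a
      counterexample for \<open>P\<close> would be one for \<open>Q\<close>.\<close>
    have "allowed D (fst P) t ops \<Longrightarrow> allowed D (fst Q) t ops"
      for t :: "('l, 'n) xtree" and ops
      using Q(1) by (induction ops arbitrary: t) (auto simp: sem_def)
    moreover have "sem D (snd P) t \<subseteq> sem D (snd Q) t" for t :: "('l, 'n) xtree"
      using Q(2) by (auto simp: sem_def)
    ultimately show ?thesis using Q(3) unfolding consistent_def by blast
  qed
  moreover have "quasiconsistent D P TYPE('n)" if "T_op D (fst P) \<inter> snd P = {}"
  proof -
    \<comment> \<open>The extension allows the closure under \<open>T_op\<close> and forbids all the
      rest, which makes it total; its closedness is \<open>T_op_idem\<close>.\<close>
    let ?S = "T_op D (fst P)" and ?Q = "(T_op D (fst P), valid D - T_op D (fst P))"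
    have P: "fst P \<subseteq> valid D" "snd P \<subseteq> valid D" using assms(4) by (auto simp: is_policy_def)
    have S: "?S \<subseteq> valid D" by (rule T_op_valid[OF P(1)])
    then have "consistent D ?Q TYPE('n)" by (rule T_closed_consistent[OF assms(3) _ T_op_idem])
    moreover have "is_policy D ?Q" "total D ?Q" using S by (auto simp: is_policy_def total_def)
    moreover have "info_le P ?Q"
      using that P(2) T_op_eq[of D "fst P"] unfolding info_le_def fst_conv snd_conv by blast
    ultimately show ?thesis unfolding quasiconsistent_def by blast
  qed
  \<comment> \<open>The implications from (1) to (2), from (2) to (3) and from (3) to (1) close the
    circle.\<close>
  ultimately show ?thesis using consistent_imp_T_disjoint[OF assms(2-4)] by blast
qed

end
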